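(* Let $q = p^r$ and suppose that $r \leq 4$ or $\ell > (q-1)/2$. Let $\alpha, \beta$ be voltage assignments such that $X^\alpha$ and $X^\beta$ are isomorphic as graphs. Then there exists a graph isomorphism $f \colon X^\alpha \to X^\beta$ of the form $f(x,i) = (t x^\sigma, n i)$ for some $t \in \mathbf{F}_q^{\boxtimes}$, $\sigma \in \mathrm{Gal}(\mathbf{F}_q/\mathbf{F}_p)$, $n \in (\mathbf{Z}/\ell)^\times$. Moreover, $n\alpha(s) = \beta(t s^\sigma)$ for all $s \in \mathbf{F}_q^{\boxtimes}$, and $X^{n\alpha}$ and $X^\beta$ are isomorphic as $\mathbf{Z}/\ell$-covering graphs.
   Context: Let $\mathbf{F}_q$ be a finite field of characteristic $p$, $q = p^r \equiv 1 \pmod 4$, $\mathbf{F}_q^{\boxtimes}$ the set of nonzero squares, and $\ell \neq p$ a prime. A voltage assignment is a function $\alpha \colon \mathbf{F}_q^{\boxtimes} \to \mathbf{Z}/\ell$, not identically zero, with $\alpha(-s) = -\alpha(s)$. The graph $X^\alpha$ has vertex set $\mathbf{F}_q \times \mathbf{Z}/\ell$, with $(x,i)$ adjacent to $(y,j)$ iff $y - x \in \mathbf{F}_q^{\boxtimes}$ and $j - i = \alpha(y-x)$; equivalently it is the Cayley graph of $\mathbf{F}_q^+ \times \mathbf{Z}/\ell$ with connection set $S^\alpha = \{(s,\alpha(s)) : s \in \mathbf{F}_q^{\boxtimes}\}$. It covers the Paley graph via $(x,i) \mapsto x$, and $\mathbf{Z}/\ell$ acts by $j \cdot (x,i) = (x,i+j)$.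 For $n \in (\mathbf{Z}/\ell)^\times$, $n\alpha$ is the voltage assignment $s \mapsto n\alpha(s)$. An isomorphism of $\mathbf{Z}/\ell$-covering graphs $X^\alpha \to X^\beta$ is a graph isomorphism $f$ with $f(x,i+j) = f(x,i) + (0,j)$ for all $x,i,j$. *)

theory Defs
  imports Main "HOL-Computational_Algebra.Primes" "HOL-Library.Cardinality"
begin

definition nzsq :: "'a::field set" where
  "nzsq = {x. x \<noteq> 0 \<and> (\<exists>y. x = y ^ 2)}"

text \<open>Z/l is modelled by the representatives {0..<l} of int, with arithmetic mod l.\<close>
definition voltage :: "int \<Rightarrow> ('a::field \<Rightarrow> int) \<Rightarrow> bool" where
  "voltage l \<alpha> \<longleftrightarrow>
     (\<forall>s\<in>nzsq. \<alpha> s \<in> {0..<l}) \<and>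
     (\<exists>s\<in>nzsq. \<alpha> s \<noteq> 0) \<and>
     (\<forall>s\<in>nzsq. \<alpha> (- s) = (- \<alpha> s) mod l)"

definition verts :: "int \<Rightarrow> ('a \<times> int) set" where
  "verts l = UNIV \<times> {0..<l}"

definition adj :: "int \<Rightarrow> ('a::field \<Rightarrow> int) \<Rightarrow> 'a \<times> int \<Rightarrow> 'a \<times> int \<Rightarrow> bool" where
  "adj l \<alpha> v w \<longleftrightarrow> snd v \<in> {0..<l} \<and> snd w \<in> {0..<l} \<and>
     fst w - fst v \<in> nzsq \<and> (snd w - snd v) mod l = \<alpha> (fst w - fst v)"

definition graph_iso :: "int \<Rightarrow> ('a::field \<Rightarrow> int) \<Rightarrow> ('a \<Rightarrow> int) \<Rightarrow> ('a \<times> int \<Rightarrow> 'a \<times> int) \<Rightarrow> bool" where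
  "graph_iso l \<alpha> \<beta> f \<longleftrightarrow> bij_betw f (verts l) (verts l) \<and>
     (\<forall>v\<in>verts l. \<forall>w\<in>verts l. adj l \<alpha> v w \<longleftrightarrow> adj l \<beta> (f v) (f w))"

definition graphs_isomorphic :: "int \<Rightarrow> ('a::field \<Rightarrow> int) \<Rightarrow> ('a \<Rightarrow> int) \<Rightarrow> bool" where
  "graphs_isomorphic l \<alpha> \<beta> \<longleftrightarrow> (\<exists>f. graph_iso l \<alpha> \<beta> f)"

definition cover_iso :: "int \<Rightarrow> ('a::field \<Rightarrow> int) \<Rightarrow> ('a \<Rightarrow> int) \<Rightarrow> ('a \<times> int \<Rightarrow> 'a \<times> int) \<Rightarrow> bool" where
  "cover_iso l \<alpha> \<beta> f \<longleftrightarrow> graph_iso l \<alpha> \<beta> f \<and>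
     (\<forall>x i j. i \<in> {0..<l} \<longrightarrow> j \<in> {0..<l} \<longrightarrow>
        f (x, (i + j) mod l) = (fst (f (x, i)), (snd (f (x, i)) + j) mod l))"

definition scale_volt :: "int \<Rightarrow> int \<Rightarrow> ('a \<Rightarrow> int) \<Rightarrow> 'a \<Rightarrow> int" where
  "scale_volt l n \<alpha> = (\<lambda>s. (n * \<alpha> s) mod l)"

text \<open>Field automorphisms of F_q; these are exactly Gal(F_q/F_p) (they fix the prime field).\<close>
definition field_aut :: "('a::field \<Rightarrow> 'a) \<Rightarrow> bool" where
  "field_aut \<sigma> \<longleftrightarrow> bij \<sigma> \<and> (\<forall>x y. \<sigma> (x + y) = \<sigma> x + \<sigma> y) \<and>
     (\<forall>x y. \<sigma> (x * y) = \<sigma> x * \<sigma> y) \<and> \<sigma> 1 = 1"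

end

theory Submission
  imports Defs "HOL-Computational_Algebra.Polynomial" "HOL-Number_Theory.Cong"
    "HOL-Algebra.Coset" "HOL-Combinatorics.Permutations"
begin

text \<open>
  In the group algebra of the vertex group over the field with \<open>l\<close> elements, the \<open>l\<close>-th power of the
  connection set \<open>{(s, \<alpha> s)}\<close> is \<open>{(l s, 0)}\<close>. Counting walks of length \<open>l\<close> modulo \<open>l\<close> therefore shows
  that a graph isomorphism permutes the slices \<open>F\<^sub>q \<times> {i}\<close> and acts on each of them as an automorphism of
  the Paley graph, that is, by Carlitz' theorem, as \<open>x \<mapsto> t\<^sub>i \<sigma>\<^sub>i(x) + c\<^sub>i\<close>. Edges between two slices force
  a coset of the image of \<open>t\<^sub>i \<sigma>\<^sub>i - t\<^sub>j \<sigma>\<^sub>j\<close> to consist of squares; as this image is zero or has at least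
  \<open>\<surd>q\<close> elements, a second moment estimate for the quadratic character makes \<open>t\<^sub>i\<close> and \<open>\<sigma>\<^sub>i\<close>
  independent of \<open>i\<close>. After untwisting by \<open>t \<sigma>\<close>, the isomorphisms commute with translations. Those among
  them that fix the slice over \<open>0\<close> are a torsor under a group whose order divides \<open>q\<^sup>l (l - 1)!\<close>, so their
  number is prime to \<open>l\<close>, and the deck group, acting on them by conjugation, has a fixed point. Such a
  fixed point is a translation in the field direction and multiplication by some \<open>n\<close> in the fibre direction.
\<close>

section \<open>Finite fields of odd order\<close>

lemma card_field_gt_1: "CARD('a::{field,finite}) > 1"
proof -
  have "card {0, 1::'a} \<le> CARD('a)" by (rule card_mono) simp_all
  then show ?thesis by simp
qed

lemma power_card_minus_1_eq_1:
  fixes x :: "'a::{field,finite}"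
  assumes "x \<noteq> 0"
  shows "x ^ (CARD('a) - 1) = 1"
proof -
  have "(\<Prod>y\<in>UNIV-{0}. x * y) = (\<Prod>y\<in>UNIV-{0}. y)"
    by (rule prod.reindex_bij_witness[of _ "\<lambda>y. y / x" "\<lambda>y. x * y"]) (use assms in auto)
  moreover have "(\<Prod>y\<in>UNIV-{0}. x * y) = x ^ (CARD('a) - 1) * \<Prod>(UNIV-{0})"
    by (simp add: prod.distrib)
  ultimately show ?thesis by simp
qed

lemma power_card_eq_self:
  fixes x :: "'a::{field,finite}"
  shows "x ^ CARD('a) = x"
proof (cases "x = 0")
  case False
  have "x ^ CARD('a) = x ^ Suc (CARD('a) - 1)"
    using card_field_gt_1[where 'a = 'a] by simp
  then show ?thesis by (simp only: power_Suc power_card_minus_1_eq_1[OF False] mult_1_right)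
qed simp

lemma power_reduce_exponent:
  fixes x :: "'a::{field,finite}"
  assumes "k > 0"
  shows "x ^ (e * (CARD('a) - 1) + k) = x ^ k"
proof (cases "x = 0")
  case False
  then show ?thesis
    by (simp add: power_add mult.commute[of e] power_mult power_card_minus_1_eq_1 del: One_nat_def)
qed (use assms in \<open>simp add: power_0_left\<close>)

text \<open>Let \<open>q\<close> be the order of the field. If \<open>q - 1\<close> does not divide
  \<open>n\<close>, some nonzero \<open>a\<close> has \<open>a ^ n \<noteq> 1\<close>, and
  substituting \<open>a * x\<close> for \<open>x\<close> multiplies the sum by \<open>a ^ n\<close>.
  Otherwise the sum consists of \<open>q - 1\<close> ones, and \<open>q = 0\<close> in the
  field.\<close>

lemma sum_powers_finite_field:
  assumes "n > 0"
  shows "(\<Sum>x\<in>(UNIV::'a::{field,finite} set). x ^ n) = (if (CARD('a) - 1) dvd n then -1 else 0)"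
proof (cases "(CARD('a) - 1) dvd n")
  case True
  then obtain e where e: "n = (CARD('a) - 1) * e" by blast
  have "(\<Sum>x\<in>(UNIV::'a set). x ^ n) = (\<Sum>x\<in>UNIV - {0}. x ^ n)"
    using assms by (intro sum.mono_neutral_right) auto
  also have "\<dots> = (\<Sum>x\<in>UNIV - {0::'a}. 1)"
    by (intro sum.cong) (auto simp: e power_mult power_card_minus_1_eq_1 simp del: One_nat_def)
  also have "\<dots> = of_nat (CARD('a) - 1)" by simp
  also have "\<dots> = of_nat CARD('a) - 1"
    by (simp add: of_nat_diff Suc_leI zero_less_card_finite)
  also have "of_nat CARD('a) = (0::'a)"
  proof -
    have "(\<Sum>x\<in>(UNIV::'a set). x + 1) = (\<Sum>x\<in>(UNIV::'a set). x)"
      by (rule sum.reindex_bij_witness[of _ "\<lambda>y. y - 1" "\<lambda>y. y + 1"]) auto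
    then show ?thesis by (simp add: sum.distrib)
  qed
  finally show ?thesis using True by simp
next
  case False
  define k where "k = n mod (CARD('a) - 1)"
  have k: "0 < k" using False by (auto simp: k_def dvd_eq_mod_eq_0)
  have k2: "k < CARD('a) - 1"
    unfolding k_def using card_field_gt_1[where 'a = 'a] by (intro mod_less_divisor) simp
  have nk: "x ^ n = x ^ k" for x :: 'a
    using power_reduce_exponent[OF k, of x "n div (CARD('a) - 1)"] by (simp only: k_def div_mult_mod_eq)
  have "\<exists>a::'a. a \<noteq> 0 \<and> a ^ k \<noteq> 1"
  proof (rule ccontr)
    assume "\<not> ?thesis"
    then have sub: "UNIV - {0} \<subseteq> {x::'a. poly (monom 1 k - 1) x = 0}"
      by (auto simp: poly_monom)
    have "degree (monom 1 k :: 'a poly) \<noteq> degree (1 :: 'a poly)"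
      using k by (simp add: degree_monom_eq)
    then have ne: "(monom 1 k - 1 :: 'a poly) \<noteq> 0" by auto
    have "CARD('a) - 1 = card (UNIV - {0::'a})" by simp
    also have "\<dots> \<le> card {x::'a. poly (monom 1 k - 1) x = 0}"
      by (rule card_mono[OF _ sub]) simp
    also have "\<dots> \<le> degree (monom 1 k - 1 :: 'a poly)"
      by (rule card_poly_roots_bound[OF ne])
    also have "\<dots> \<le> k"
      by (rule degree_diff_le) (simp_all add: degree_monom_le)
    finally show False using k2 by simp
  qed
  then obtain a :: 'a where a: "a \<noteq> 0" "a ^ k \<noteq> 1" by blast
  have "(\<Sum>x\<in>(UNIV::'a set). (a * x) ^ k) = (\<Sum>x\<in>(UNIV::'a set). x ^ k)"
    by (rule sum.reindex_bij_witness[of _ "\<lambda>y. y / a" "\<lambda>y. a * y"]) (use a in auto)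
  then have "a ^ k * (\<Sum>x\<in>(UNIV::'a set). x ^ k) = (\<Sum>x\<in>(UNIV::'a set). x ^ k)"
    by (simp add: power_mult_distrib sum_distrib_left)
  then have "(\<Sum>x\<in>(UNIV::'a set). x ^ k) = 0" using a by simp
  then show ?thesis using False by (simp add: nk)
qed

text \<open>Nonzero squares are roots of \<open>X ^ m - 1\<close>, so there are at most
  \<open>m\<close> of them; squaring is at most two-to-one on the \<open>2 * m\<close> nonzero
  elements, so there are at least \<open>m\<close>.\<close>

lemma nzsq_eq_power_half_card:
  assumes q: "CARD('a::{field,finite}) = 2 * m + 1"
  shows "nzsq = {x::'a. x ^ m = 1}" and "card (nzsq :: 'a set) = m"
proof -
  have m: "m > 0"
    using q card_field_gt_1[where 'a = 'a] by simp
  have "degree (monom 1 m :: 'a poly) \<noteq> degree (1 :: 'a poly)"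
    using m by (simp add: degree_monom_eq)
  then have ne: "(monom 1 m - 1 :: 'a poly) \<noteq> 0" by auto
  have sub: "nzsq \<subseteq> {x::'a. x ^ m = 1}"
  proof
    fix x :: 'a assume "x \<in> nzsq"
    then obtain y where "x = y ^ 2" "y \<noteq> 0" by (auto simp: nzsq_def)
    then show "x \<in> {x. x ^ m = 1}"
      using power_card_minus_1_eq_1[of y] q by (simp flip: power_mult)
  qed
  have "card {x::'a. x ^ m = 1} = card {x::'a. poly (monom 1 m - 1) x = 0}"
    by (simp add: poly_monom)
  also have "\<dots> \<le> degree (monom 1 m - 1 :: 'a poly)"
    by (rule card_poly_roots_bound[OF ne])
  also have "\<dots> \<le> m"
    by (rule degree_diff_le) (simp_all add: degree_monom_le)
  finally have upper: "card {x::'a. x ^ m = 1} \<le> m" .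
  have fib: "card {y::'a. y ^ 2 = s} \<le> 2" for s
  proof -
    have "card {y::'a. y ^ 2 = s} = card {y. poly [:-s, 0, 1:] y = 0}"
      by (simp add: power2_eq_square)
    also have "\<dots> \<le> degree [:-s, 0, 1:]"
      by (rule card_poly_roots_bound) simp
    finally show ?thesis by simp
  qed
  have "2 * m = card (UNIV - {0::'a})" using q by simp
  also have "UNIV - {0::'a} = (\<Union>s\<in>nzsq. {y. y ^ 2 = s})"
    by (auto simp: nzsq_def)
  also have "card \<dots> \<le> (\<Sum>s\<in>(nzsq::'a set). card {y::'a. y ^ 2 = s})"
    by (rule card_UN_le) simp
  also have "\<dots> \<le> (\<Sum>s\<in>(nzsq::'a set). 2)"
    by (rule sum_mono) (rule fib)
  finally have lower: "m \<le> card (nzsq::'a set)" by simp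
  show "nzsq = {x::'a. x ^ m = 1}"
    using card_seteq[OF _ sub] upper lower by simp
  then show "card (nzsq :: 'a set) = m" using upper lower by simp
qed

lemma power_half_card:
  fixes x :: "'a::{field,finite}"
  assumes q: "CARD('a) = 2 * m + 1" and "x \<noteq> 0"
  shows "x ^ m = (if x \<in> nzsq then 1 else - 1)"
proof -
  have "(x ^ m) ^ 2 = 1"
    using power_card_minus_1_eq_1[OF assms(2)] q by (simp add: mult.commute flip: power_mult)
  then have "x ^ m = 1 \<or> x ^ m = -1" by (simp add: power2_eq_1_iff)
  then show ?thesis using nzsq_eq_power_half_card(1)[OF q] by auto
qed

text \<open>One digit of Lucas' theorem: in characteristic \<open>p\<close>, compare the
  coefficients of \<open>X ^ (a + p * b)\<close> in
  \<open>(1 + X) ^ (u + p * v) = (1 + X ^ p) ^ v * (1 + X) ^ u\<close>. As \<open>u < p\<close>,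
  only the term \<open>k = b\<close> of the first factor contributes.\<close>

lemma not_dvd_choose_digit:
  fixes p u v a b :: nat
  assumes ch: "CHAR('a::field) = p" and p: "prime p"
    and u: "u < p" and ua: "\<not> p dvd u choose a" and vb: "\<not> p dvd v choose b"
  shows "\<not> p dvd (u + p * v) choose (a + p * b)"
proof -
  have a: "a \<le> u" and b: "b \<le> v"
    using ua vb by (metis binomial_eq_0_iff dvd_0_right linorder_not_le)+
  let ?X = "[:1, 1:] :: 'a poly"
  have chp: "CHAR('a poly) = p" using ch by simp
  have eq: "?X = 1 + monom 1 1" by (rule poly_eqI) (auto simp: coeff_pCons split: nat.splits)
  have "(1 + monom 1 1 :: 'a poly) ^ p = 1 ^ p + monom 1 1 ^ p"
    by (rule freshmans_dream) (simp_all only: chp p)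
  then have "?X ^ p = 1 + monom 1 p"
    by (simp only: eq monom_power power_one mult_1_left)
  then have "?X ^ (u + p * v) = (monom 1 p + 1) ^ v * ?X ^ u"
    by (simp only: power_add power_mult add.commute[of 1] mult.commute)
  also have "\<dots> = (\<Sum>k\<le>v. monom (of_nat (v choose k)) (p * k) * ?X ^ u)"
    by (simp add: binomial_ring sum_distrib_left sum_distrib_right monom_power of_nat_monom mult_monom mult.commute)
  finally have "coeff (?X ^ (u + p * v)) (a + p * b) =
      (\<Sum>k\<le>v. coeff (monom (of_nat (v choose k)) (p * k) * ?X ^ u) (a + p * b))"
    by (simp add: coeff_sum)
  also have "\<dots> = (\<Sum>k\<le>v. if k = b then of_nat (v choose b) * of_nat (u choose a) else 0)"
  proof (intro sum.cong refl)
    fix k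
    show "coeff (monom (of_nat (v choose k)) (p * k) * ?X ^ u) (a + p * b) =
      (if k = b then of_nat (v choose b) * of_nat (u choose a) else 0)"
    proof (cases k b rule: linorder_cases)
      case less
      then have "p * Suc k \<le> p * b" by (intro mult_le_mono2) simp
      then have "a + p * b - p * k > u" using u by (simp add: less_diff_conv)
      then show ?thesis using less
        by (simp add: coeff_monom_mult coeff_eq_0 degree_linear_power)
    next
      case equal
      then show ?thesis using a by (simp add: coeff_monom_mult coeff_linear_poly_power)
    next
      case greater
      then have "p * Suc b \<le> p * k" by (intro mult_le_mono2) simp
      then have "a + p * b < p * k" using a u by simp
      then show ?thesis using greater by (simp add: coeff_monom_mult)
    qed
  qed
  also have "\<dots> = of_nat (v choose b) * of_nat (u choose a)"
    using b by simp
  moreover have "a + p * b \<le> u + p * v" using a b by (simp add: add_mono)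
  ultimately have "(of_nat ((u + p * v) choose (a + p * b)) :: 'a) = of_nat (v choose b) * of_nat (u choose a)"
    by (simp add: coeff_linear_poly_power)
  then show ?thesis
    using ua vb ch by (metis no_zero_divisors of_nat_eq_0_iff_char_dvd)
qed

section \<open>Automorphisms of the Paley graph\<close>

text \<open>Expanding \<open>(y - c) ^ m\<close> leaves power sums over \<open>c\<close> with
  exponents strictly between \<open>0\<close> and \<open>4 * m\<close>. Only the exponent
  \<open>2 * m\<close>, attained at \<open>k = i\<close>, gives a nonzero sum. This recovers
  \<open>y ^ i\<close> from the values \<open>(y - c) ^ m\<close>.\<close>

lemma sum_shifted_power_times_power:
  fixes y :: "'a::{field,finite}"
  assumes q: "CARD('a) = 2 * m + 1" and i: "i \<le> m"
  shows "(\<Sum>c\<in>UNIV. (y - c) ^ m * c ^ (m + i)) = - ((-1) ^ (m - i)) * of_nat (m choose i) * y ^ i"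
proof -
  have m: "m > 0" using q card_field_gt_1[where 'a = 'a] by simp
  have "(\<Sum>c\<in>UNIV. (y - c) ^ m * c ^ (m + i)) =
      (\<Sum>c\<in>UNIV. \<Sum>k\<le>m. of_nat (m choose k) * y ^ k * (-1) ^ (m - k) * c ^ (m - k + (m + i)))"
  proof (rule sum.cong[OF refl])
    fix c :: 'a
    have "(y - c) ^ m = (y + - c) ^ m" by simp
    also have "\<dots> = (\<Sum>k\<le>m. of_nat (m choose k) * y ^ k * (- c) ^ (m - k))"
      by (rule binomial_ring)
    finally show "(y - c) ^ m * c ^ (m + i) =
        (\<Sum>k\<le>m. of_nat (m choose k) * y ^ k * (-1) ^ (m - k) * c ^ (m - k + (m + i)))"
      by (simp only: sum_distrib_right power_add power_minus[of c] mult.assoc)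
  qed
  also have "\<dots> = (\<Sum>k\<le>m. of_nat (m choose k) * y ^ k * (-1) ^ (m - k) * (\<Sum>c\<in>UNIV. c ^ (m - k + (m + i))))"
    by (subst sum.swap) (simp add: sum_distrib_left)
  also have "\<dots> = (\<Sum>k\<le>m. if k = i then - ((-1) ^ (m - i)) * of_nat (m choose i) * y ^ i else 0)"
  proof (rule sum.cong[OF refl])
    fix k assume "k \<in> {..m}"
    then have k: "k \<le> m" by simp
    have dvd: "2 * m dvd m - k + (m + i) \<longleftrightarrow> k = i"
    proof
      assume "2 * m dvd m - k + (m + i)"
      then obtain e where e: "m - k + (m + i) = 2 * m * e" by blast
      have "0 < m - k + (m + i)" using m by simp
      then have "e \<noteq> 0" using e by auto
      moreover have "e < 2"
      proof (rule ccontr)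
        assume "\<not> e < 2"
        then have "2 * m * 2 \<le> 2 * m * e" by (intro mult_le_mono2) simp
        then show False using e i k m by linarith
      qed
      ultimately have "e = 1" by simp
      then show "k = i" using e k i by simp
    qed (use k in \<open>simp flip: mult_2\<close>)
    show "of_nat (m choose k) * y ^ k * (-1) ^ (m - k) * (\<Sum>c\<in>UNIV. c ^ (m - k + (m + i))) =
        (if k = i then - ((-1) ^ (m - i)) * of_nat (m choose i) * y ^ i else 0)"
      using m dvd by (subst sum_powers_finite_field) (auto simp: q)
  qed
  also have "\<dots> = - ((-1) ^ (m - i)) * of_nat (m choose i) * y ^ i" using i by simp
  finally show ?thesis .
qed

text \<open>The preceding sum at \<open>y = f x\<close>, reindexed by \<open>c = f b\<close>,
  contains \<open>(f x - f b) ^ m = (x - b) ^ m\<close>, a polynomial of degree \<open>m\<close> in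
  \<open>x\<close>. The condition on the binomial coefficient allows division by it.\<close>

lemma power_eq_poly_if_preserves_half_power:
  fixes f :: "'a::{field,finite} \<Rightarrow> 'a"
  assumes q: "CARD('a) = 2 * m + 1" and f: "bij f"
    and pres: "\<And>x y. (f x - f y) ^ m = (x - y) ^ m"
    and i: "\<not> CHAR('a) dvd m choose i"
  shows "\<exists>P. degree P \<le> m \<and> (\<forall>x. poly P x = f x ^ i)"
proof -
  have im: "i \<le> m"
    using i by (metis binomial_eq_0_iff dvd_0_right linorder_not_le)
  define c :: 'a where "c = - ((-1) ^ (m - i)) * of_nat (m choose i)"
  have c: "c \<noteq> 0"
    using i by (simp add: c_def of_nat_eq_0_iff_char_dvd)
  define P where "P = smult (inverse c) (\<Sum>b\<in>UNIV. smult (f b ^ (m + i)) ([:-b, 1:] ^ m))"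
  have "degree (smult (f b ^ (m + i)) ([:-b, 1:] ^ m)) \<le> m" for b
    by (rule order.trans[OF degree_smult_le]) (simp add: degree_linear_power)
  then have "degree (\<Sum>b\<in>UNIV. smult (f b ^ (m + i)) ([:-b, 1:] ^ m)) \<le> m"
    by (intro degree_sum_le) (simp_all only: finite)
  then have "degree P \<le> m"
    unfolding P_def by (rule order.trans[OF degree_smult_le])
  moreover have "poly P x = f x ^ i" for x
  proof -
    have "c * poly P x = (\<Sum>b\<in>UNIV. (x - b) ^ m * f b ^ (m + i))"
      using c by (simp add: P_def poly_sum poly_power algebra_simps)
    also have "\<dots> = (\<Sum>b\<in>UNIV. (f x - f b) ^ m * f b ^ (m + i))"
      by (simp add: pres)
    also have "\<dots> = (\<Sum>b\<in>UNIV. (f x - b) ^ m * b ^ (m + i))"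
      using sum.reindex_bij_betw[OF f, of "\<lambda>b. (f x - b) ^ m * b ^ (m + i)"] by simp
    also have "\<dots> = c * f x ^ i"
      unfolding c_def by (rule sum_shifted_power_times_power[OF q im])
    finally show ?thesis using c by simp
  qed
  ultimately show ?thesis by blast
qed

lemma factor_of_monom:
  fixes P Q :: "'a::idom poly"
  assumes "P * Q = monom c n" "c \<noteq> 0"
  obtains d e where "P = monom d e"
proof -
  have "\<exists>d e. P = monom d e"
    using assms(1)
  proof (induction n arbitrary: P Q)
    case 0
    then have "P * Q \<noteq> 0" using assms(2) by simp
    then have ne: "P \<noteq> 0" "Q \<noteq> 0" by auto
    have "degree P + degree Q = 0"
      using 0 degree_mult_eq[OF ne] by (simp add: monom_0)
    then have "degree P = 0" by simp
    then show ?case by (metis degree_eq_zeroE monom_0)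
  next
    case (Suc n)
    have mon: "monom c (Suc n) = [:0, 1:] * monom c n"
      by (simp add: monom_Suc)
    have "poly P 0 * poly Q 0 = 0"
      using arg_cong[OF Suc.prems, of "\<lambda>R. poly R 0"] by (simp add: poly_monom)
    then consider "poly P 0 = 0" | "poly Q 0 = 0" by auto
    then show ?case
    proof cases
      case 1
      then obtain P' where P': "P = [:0, 1:] * P'" by (auto simp: poly_eq_0_iff_dvd)
      then have "[:0, 1:] * (P' * Q) = [:0, 1:] * monom c n"
        using Suc.prems mon by (simp only: mult.assoc)
      then have "P' * Q = monom c n" by (simp only: mult_cancel_left) simp
      then obtain d e where "P' = monom d e" using Suc.IH by blast
      then have "P = monom d (Suc e)" using P' by (simp add: monom_Suc)
      then show ?thesis by blast
    next
      case 2
      then obtain Q' where Q': "Q = [:0, 1:] * Q'" by (auto simp: poly_eq_0_iff_dvd)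
      then have "[:0, 1:] * (P * Q') = [:0, 1:] * monom c n"
        using Suc.prems mon by (simp only: mult.left_commute)
      then have "P * Q' = monom c n" by (simp only: mult_cancel_left) simp
      then show ?thesis using Suc.IH by blast
    qed
  qed
  then show ?thesis using that by blast
qed

text \<open>Cyclic digit shifts: multiplying the exponent by \<open>p\<close> modulo \<open>p ^ r - 1\<close> carries exactly once,
  which pins one of the shifted exponents to \<open>1\<close>.\<close>

lemma cyclic_exponents_contain_one:
  fixes d e :: "nat \<Rightarrow> nat"
  assumes p: "p > 1" and r: "r > 0"
    and step: "\<And>j. j < r \<Longrightarrow> p * d j = e j * (p ^ r - 1) + d (Suc j)"
    and cyc: "d r = d 0" and total: "(p - 1) * (\<Sum>j<r. d j) = p ^ r - 1"
  shows "\<exists>j\<le>r. d j = 1"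
proof -
  let ?D = "\<Sum>j<r. d j"
  have q1: "p ^ r - 1 > 0" using one_less_power[OF p r] by simp
  have shift: "(\<Sum>j<r. d (Suc j)) = ?D"
    using sum.lessThan_Suc_shift[of d r] sum.lessThan_Suc[of d r] cyc by simp
  have "p * ?D = (\<Sum>j<r. e j * (p ^ r - 1) + d (Suc j))"
    by (simp add: sum_distrib_left step)
  also have "\<dots> = (\<Sum>j<r. e j) * (p ^ r - 1) + ?D"
    by (simp add: sum.distrib sum_distrib_right shift)
  finally have "(\<Sum>j<r. e j) * (p ^ r - 1) = (p - 1) * ?D"
    using p by (simp add: diff_mult_distrib)
  \<comment> \<open>There is exactly one carry, at an index \<open>J\<close>; all other steps merely
    multiply by \<open>p\<close>.\<close>
  then have "(\<Sum>j<r. e j) = 1" using total q1 by simp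
  then obtain J where J: "J < r" "e J = 1" "\<And>j. j < r \<Longrightarrow> j \<noteq> J \<Longrightarrow> e j = 0"
    by (auto simp: sum_eq_Suc0_iff)
  have low: "d j = p ^ j * d 0" if "j \<le> J" for j
    using that
  proof (induction j)
    case (Suc j)
    then have "d (Suc j) = p * d j" using step[of j] J by simp
    then show ?case using Suc by simp
  qed simp
  have high: "d (Suc J + k) = p ^ k * d (Suc J)" if "Suc J + k \<le> r" for k
    using that
  proof (induction k)
    case (Suc k)
    then have "d (Suc (Suc J + k)) = p * d (Suc J + k)" using step[of "Suc J + k"] J by simp
    then show ?case using Suc by simp
  qed simp
  \<comment> \<open>Starting after the carry and going once around the cycle multiplies
    \<open>?u\<close> by \<open>p ^ r\<close>, subtracts \<open>p ^ r - 1\<close> at the very end,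
    and must return to \<open>?u\<close>.\<close>
  let ?u = "d (Suc J)"
  have "d 0 = p ^ (r - Suc J) * ?u" using high[of "r - Suc J"] J(1) cyc by simp
  then have "p * d J = p * (p ^ J * p ^ (r - Suc J)) * ?u" using low[of J] by simp
  also have "p * (p ^ J * p ^ (r - Suc J)) = p ^ r"
    using J(1) by (simp flip: power_add power_Suc)
  finally have "p ^ r * ?u = (p ^ r - 1) + ?u" using step[OF J(1)] J(2) by simp
  then have "(p ^ r - 1) * ?u = (p ^ r - 1) * 1" by (simp add: diff_mult_distrib)
  then have "?u = 1" using q1 by (simp only: mult_cancel1) simp
  then show ?thesis using J(1) by (intro exI[of _ "Suc J"]) simp
qed

text \<open>The powers \<open>f ^ (p ^ j)\<close> are polynomials \<open>G j\<close> of degree at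
  most \<open>m\<close>, and \<open>f ^ m\<close> is the product of their \<open>h\<close>-th
  powers, since every base-\<open>p\<close> digit of \<open>m\<close> is \<open>h\<close>. This
  product equals \<open>X ^ m\<close>, so each \<open>G j\<close> is a monomial. Raising to the
  \<open>p\<close>-th power shifts \<open>j\<close> cyclically, and counting carries shows that one
  exponent is \<open>1\<close>.\<close>

lemma bij_preserving_half_power_is_inverse_frobenius:
  fixes f :: "'a::{field,finite} \<Rightarrow> 'a"
  assumes p: "prime p" and ch: "CHAR('a) = p" and card: "CARD('a) = p ^ r"
    and q: "CARD('a) = 2 * m + 1" and f: "bij f" and f0: "f 0 = 0" and f1: "f 1 = 1"
    and pres: "\<And>x y. (f x - f y) ^ m = (x - y) ^ m"
  shows "\<exists>k. \<forall>x. f x ^ (p ^ k) = x"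
proof -
  have r: "r > 0" using card card_field_gt_1[where 'a = 'a] by (cases r) auto
  have oddp: "odd p" using q card r by (metis even_Suc even_power even_mult_iff Suc_eq_plus1 even_numeral)
  define h where "h = (p - 1) div 2"
  have ph: "p = 2 * h + 1" using oddp by (auto simp: h_def elim!: oddE)
  have h: "0 < h" "h < p" using prime_gt_1_nat[OF p] ph by auto
  \<comment> \<open>\<open>M k\<close> has \<open>k\<close> base-\<open>p\<close> digits, all equal
    to \<open>h\<close>; in particular \<open>m = M r\<close>.\<close>
  define M where "M k = h * (\<Sum>j<k. p ^ j)" for k
  have M0: "M 0 = 0" by (simp add: M_def)
  have MS: "M (Suc k) = h + p * M k" for k
    by (simp only: M_def sum.lessThan_Suc_shift) (simp add: sum_distrib_left algebra_simps)
  have M2: "2 * M k + 1 = p ^ k" for k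
  proof (induction k)
    case (Suc k)
    have "2 * M (Suc k) + 1 = (2 * h + 1) + p * (2 * M k)" by (simp add: MS)
    also have "\<dots> = p * (2 * M k + 1)" unfolding distrib_left using ph by simp
    finally show ?case by (simp only: Suc power_Suc)
  qed (simp add: M0)
  have mM: "m = M r" using M2[of r] card q by simp
  have small: "\<not> p dvd h choose a" if "a \<le> h" for a
  proof
    assume "p dvd h choose a"
    then have "p dvd fact a * fact (h - a) * (h choose a)" by simp
    then have "p dvd fact h" by (simp only: binomial_fact_lemma[OF that])
    then show False using h p by (simp add: prime_dvd_fact_iff)
  qed
  have digit: "\<not> p dvd (M (Suc n) choose (a + p * b))" if "a \<le> h" "\<not> p dvd (M n choose b)" for n a b
    unfolding MS by (rule not_dvd_choose_digit[OF ch p h(2) small[OF that(1)] that(2)])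
  \<comment> \<open>All base-\<open>p\<close> digits of \<open>M k + a * p ^ k\<close> are at most
    \<open>h\<close>. These are the exponents of the partial products when \<open>f ^ m\<close> is
    built up one factor at a time.\<close>
  have ch1: "\<not> p dvd (M (k + Suc n) choose (M k + a * p ^ k))" if "a \<le> h" for a k n
  proof (induction k)
    case 0
    have "\<not> p dvd (M (Suc n) choose (a + p * 0))" by (rule digit[OF that]) (use p in auto)
    then show ?case by (simp add: M0)
  next
    case (Suc k)
    have "\<not> p dvd (M (Suc (k + Suc n)) choose (h + p * (M k + a * p ^ k)))"
      by (rule digit[OF _ Suc]) simp
    then show ?case by (simp add: MS algebra_simps)
  qed
  have ch2: "\<not> p dvd (M (k + Suc n) choose p ^ k)" for k n
  proof (induction k)
    case 0
    have "\<not> p dvd (M (Suc n) choose (1 + p * 0))" by (rule digit) (use p h in auto)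
    then show ?case by simp
  next
    case (Suc k)
    have "\<not> p dvd (M (Suc (k + Suc n)) choose (0 + p * p ^ k))"
      by (rule digit[OF _ Suc]) simp
    then show ?case by simp
  qed
  have good: "\<exists>P. degree P \<le> m \<and> (\<forall>x. poly P x = f x ^ i)" if "\<not> p dvd m choose i" for i
    by (rule power_eq_poly_if_preserves_half_power[OF q f pres]) (use that ch in simp)
  have "\<forall>j. \<exists>P. j < r \<longrightarrow> degree P \<le> m \<and> (\<forall>x. poly P x = f x ^ (p ^ j))"
  proof
    fix j
    show "\<exists>P. j < r \<longrightarrow> degree P \<le> m \<and> (\<forall>x. poly P x = f x ^ (p ^ j))"
      using good[of "p ^ j"] ch2[of j "r - Suc j"] mM by (cases "j < r") auto
  qed
  then obtain G where G: "\<And>j. j < r \<Longrightarrow> degree (G j) \<le> m"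
      "\<And>j x. j < r \<Longrightarrow> poly (G j) x = f x ^ (p ^ j)"
    by metis
  \<comment> \<open>Two factors of degree at most \<open>m\<close> multiply without reduction modulo \<open>X ^ q - X\<close>,
      so the product expansion of \<open>f ^ m\<close> holds as an identity of polynomials.\<close>
  have step: "degree (R * G k) \<le> m"
    if kr: "k < r" and R: "degree R \<le> m" "\<And>x. poly R x = f x ^ i" and i: "\<not> p dvd m choose (i + p ^ k)" for R k i
  proof -
    obtain P where P: "degree P \<le> m" "\<And>x. poly P x = f x ^ (i + p ^ k)"
      using good[OF i] by blast
    have "R * G k = P"
    proof (rule poly_eqI_degree[of UNIV])
      show "degree (R * G k) < CARD('a)"
        using degree_mult_le[of R "G k"] R(1) G(1)[OF kr] q by simp
    qed (use P R G(2)[OF kr] q in \<open>simp_all add: power_add\<close>)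
    then show ?thesis using P by simp
  qed
  \<comment> \<open>Each partial product represents a power of \<open>f\<close> whose exponent has
    all digits at most \<open>h\<close>, so multiplying by one more \<open>G k\<close> keeps the
    degree at most \<open>m\<close>.\<close>
  have chain: "degree ((\<Prod>j<k. G j ^ h) * G k ^ a) \<le> m" if "k < r" "a \<le> h"
    "degree (\<Prod>j<k. G j ^ h) \<le> m" for k a
    using that(2)
  proof (induction a)
    case 0
    then show ?case using that by simp
  next
    case (Suc a)
    have "poly ((\<Prod>j<k. G j ^ h) * G k ^ a) x = f x ^ (M k + a * p ^ k)" for x
    proof -
      have "(\<Prod>j<k. (f x ^ p ^ j) ^ h) = f x ^ M k"
        by (simp add: M_def power_sum[symmetric] sum_distrib_left power_mult[symmetric] mult.commute)
      then show ?thesis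
        using that(1) G(2) by (simp add: poly_prod poly_power power_add mult.commute[of a] power_mult)
    qed
    moreover have "\<not> p dvd m choose (M k + a * p ^ k + p ^ k)"
      using ch1[OF Suc.prems, of k "r - Suc k"] that(1) mM by (simp add: algebra_simps)
    ultimately have "degree ((\<Prod>j<k. G j ^ h) * G k ^ a * G k) \<le> m"
      using that Suc by (intro step) auto
    then show ?case by (simp add: mult_ac)
  qed
  have prefix: "degree (\<Prod>j<k. G j ^ h) \<le> m" if "k \<le> r" for k
    using that by (induction k) (use chain[of _ h] in simp_all)
  have prod: "(\<Prod>j<r. G j ^ h) = monom 1 m"
  proof (rule poly_eqI_degree[of UNIV])
    fix x
    have "(\<Prod>j<r. (f x ^ p ^ j) ^ h) = f x ^ M r"
      by (simp add: M_def power_sum[symmetric] sum_distrib_left power_mult[symmetric] mult.commute)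
    then have "(\<Prod>j<r. (f x ^ p ^ j) ^ h) = x ^ m"
      using pres[of x 0] f0 mM by simp
    then show "poly (\<Prod>j<r. G j ^ h) x = poly (monom 1 m) x"
      using G(2) by (simp add: poly_prod poly_power poly_monom)
  qed (use prefix[of r] q in \<open>simp_all add: degree_monom_eq\<close>)
  \<comment> \<open>The index \<open>r\<close> wraps around to \<open>0\<close> because
    \<open>f x ^ (p ^ r) = f x\<close>.\<close>
  define d where "d j = degree (G (if j = r then 0 else j))" for j
  have Gm: "G j = monom 1 (d j)" "0 < d j" if j: "j < r" for j
  proof -
    have "G j dvd G j ^ h" using h by (simp add: dvd_power)
    also have "\<dots> dvd (\<Prod>j<r. G j ^ h)" using j by (intro dvd_prodI) auto
    finally obtain Q where "G j * Q = monom 1 m" unfolding prod by (metis dvd_def)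
    then obtain c e where ce: "G j = monom c e" by (rule factor_of_monom) simp
    have c: "c = 1" using G(2)[OF j, of 1] ce f1 by (simp add: poly_monom)
    then have e: "e = d j" using ce j by (simp add: d_def degree_monom_eq)
    show "G j = monom 1 (d j)" using ce c e by simp
    show "0 < d j"
      using G(2)[OF j, of 0] ce c e f0 prime_gt_0_nat[OF p] by (cases "d j") (auto simp: poly_monom power_0_left)
  qed
  have dr: "d r = d 0" using r by (simp add: d_def)
  have fd: "f x ^ (p ^ j) = x ^ d j" if "j \<le> r" for j x
  proof (cases "j = r")
    case True
    then show ?thesis
      using G(2)[of 0 x] Gm(1)[of 0] r dr power_card_eq_self[of "f x"] card by (simp add: poly_monom)
  next
    case False
    then show ?thesis using G(2)[of j x] Gm(1)[of j] that by (simp add: poly_monom)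
  qed
  have dpos: "0 < d j" if "j \<le> r" for j
    using Gm(2)[of j] Gm(2)[of 0] dr r that by (cases "j = r") auto
  have dm: "d j \<le> m" if "j \<le> r" for j
    using G(1)[of j] G(1)[of 0] r that by (cases "j = r") (auto simp: d_def)
  \<comment> \<open>Subtracting \<open>1\<close> before dividing puts the remainder
    \<open>\<rho>\<close> in the range from \<open>1\<close> to \<open>p ^ r - 1\<close>; an
    exponent \<open>0\<close> would be wrong at \<open>x = 0\<close>.\<close>
  define e where "e j = (p * d j - 1) div (p ^ r - 1)" for j
  have stp: "p * d j = e j * (p ^ r - 1) + d (Suc j)" if j: "j < r" for j
  proof -
    define \<rho> where "\<rho> = (p * d j - 1) mod (p ^ r - 1) + 1"
    have "0 < p * d j" using dpos[of j] j prime_gt_0_nat[OF p] by simp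
    then have \<rho>: "p * d j = e j * (p ^ r - 1) + \<rho>"
      using div_mult_mod_eq[of "p * d j - 1" "p ^ r - 1"] unfolding e_def \<rho>_def by linarith
    have q1: "p ^ r - 1 > 0" using card_field_gt_1[where 'a = 'a] card by simp
    have \<rho>q: "\<rho> < CARD('a)" "0 < \<rho>"
      using mod_less_divisor[OF q1, of "p * d j - 1"] card by (auto simp: \<rho>_def)
    have "monom 1 \<rho> = (monom 1 (d (Suc j)) :: 'a poly)"
    proof (rule poly_eqI_degree[of UNIV])
      fix x :: 'a
      have "x ^ \<rho> = x ^ (d j * p)"
        using power_reduce_exponent[OF \<rho>q(2), of x "e j"] \<rho> card by (simp add: mult.commute)
      also have "\<dots> = f x ^ (p ^ Suc j)"
        using fd[of j x] j by (simp add: power_mult mult.commute[of p])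
      also have "\<dots> = x ^ d (Suc j)" using fd[of "Suc j" x] j by simp
      finally show "poly (monom 1 \<rho>) x = poly (monom 1 (d (Suc j))) x" by (simp add: poly_monom)
    qed (use \<rho>q dm[of "Suc j"] j q in \<open>simp_all add: degree_monom_eq\<close>)
    then have "\<rho> = d (Suc j)" by (metis degree_monom_eq zero_neq_one)
    then show ?thesis using \<rho> by simp
  qed
  \<comment> \<open>Comparing degrees in the product expresses \<open>m\<close> as \<open>h\<close>
    times the sum of the exponents, and \<open>2 * h = p - 1\<close>.\<close>
  have "(p - 1) * (\<Sum>j<r. d j) = p ^ r - 1"
  proof -
    have "m = degree (\<Prod>j<r. G j ^ h)" by (simp add: prod degree_monom_eq)
    also have "(\<Prod>j<r. G j ^ h) = (\<Prod>j<r. monom 1 (d j * h))"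
      by (rule prod.cong) (simp_all add: Gm monom_power)
    also have "degree \<dots> = (\<Sum>j<r. d j * h)"
      by (subst degree_prod_sum_eq) (simp_all add: degree_monom_eq)
    also have "\<dots> = h * (\<Sum>j<r. d j)" by (simp add: sum_distrib_left mult.commute)
    finally have "2 * m = 2 * (h * (\<Sum>j<r. d j))" by simp
    then show ?thesis using ph q card by (simp add: mult.assoc)
  qed
  then obtain j where "j \<le> r" "d j = 1"
    using cyclic_exponents_contain_one[of p r d e] prime_gt_1_nat[OF p] r stp dr by blast
  then show ?thesis using fd by (intro exI[of _ j]) simp
qed

text \<open>Carlitz' theorem. Normalising by \<open>f 0\<close> and \<open>t = f 1 - f 0\<close>
  gives a map \<open>g\<close> fixing \<open>0\<close> and \<open>1\<close>; Euler's criterion turns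
  preservation of squares into preservation of \<open>m\<close>-th powers. As \<open>g\<close>
  inverts a power of Frobenius, it is a field automorphism.\<close>

theorem paley_automorphism_semilinear:
  fixes f :: "'a::{field,finite} \<Rightarrow> 'a"
  assumes "prime p" and ch: "CHAR('a) = p" and card: "CARD('a) = p ^ r"
    and odd: "odd CARD('a)" and f: "bij f"
    and pres: "\<And>x y. f x - f y \<in> nzsq \<longleftrightarrow> x - y \<in> nzsq"
  obtains t \<sigma> c where "t \<in> nzsq" "field_aut \<sigma>" "\<And>x. f x = t * \<sigma> x + c"
proof -
  obtain m where q: "CARD('a) = 2 * m + 1" using odd by (elim oddE)
  define t where "t = f 1 - f 0"
  have "1 \<in> (nzsq :: 'a set)" by (auto simp: nzsq_def intro: exI[of _ 1])
  then have t: "t \<in> nzsq" using pres[of 1 0] by (simp add: t_def)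
  have t0: "t \<noteq> 0" using t by (simp add: nzsq_def)
  have tm: "t ^ m = 1" using t nzsq_eq_power_half_card(1)[OF q] by auto
  define g where "g x = (f x - f 0) / t" for x
  have "bij g"
  proof -
    have "inj g" using f t0 by (auto simp: g_def inj_def bij_def)
    then show ?thesis by (simp add: bij_def finite_UNIV_inj_surj)
  qed
  have g01: "g 0 = 0" "g 1 = 1" using t0 by (simp_all add: g_def t_def)
  have gp: "(g x - g y) ^ m = (x - y) ^ m" for x y
  proof -
    have "g x - g y = (f x - f y) / t" by (simp add: g_def flip: diff_divide_distrib)
    then have "(g x - g y) ^ m = (f x - f y) ^ m" using tm by (simp add: power_divide)
    also have "\<dots> = (x - y) ^ m"
    proof (cases "x = y")
      case False
      then have "f x \<noteq> f y" using f by (auto simp: bij_def inj_def)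
      then show ?thesis using power_half_card[OF q, of "f x - f y"] power_half_card[OF q, of "x - y"] False pres
        by simp
    qed simp
    finally show ?thesis .
  qed
  obtain k where k: "\<And>x. g x ^ (p ^ k) = x"
    using bij_preserving_half_power_is_inverse_frobenius[OF assms(1) ch card q \<open>bij g\<close> g01 gp] by auto
  \<comment> \<open>Identities for \<open>g\<close> may be checked after applying this power of
    Frobenius, a ring homomorphism that undoes \<open>g\<close>.\<close>
  have inj: "a = b" if "a ^ (p ^ k) = b ^ (p ^ k)" for a b :: 'a
  proof -
    obtain x y where "a = g x" "b = g y" using \<open>bij g\<close> by (metis bij_pointE)
    then show ?thesis using that k by simp
  qed
  have "field_aut g"
    unfolding field_aut_def
  proof (intro conjI allI)
    fix x y
    have add: "(g x + g y) ^ (p ^ k) = g x ^ (p ^ k) + g y ^ (p ^ k)"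
      by (rule freshmans_dream'[where n = k]) (simp_all only: ch assms(1))
    show "g (x + y) = g x + g y" by (rule inj[of "g (x + y)"]) (simp only: k add)
    show "g (x * y) = g x * g y" by (rule inj[of "g (x * y)"]) (simp only: k power_mult_distrib)
  qed (use \<open>bij g\<close> g01 in auto)
  moreover have "f x = t * g x + f 0" for x using t0 by (simp add: g_def)
  ultimately show ?thesis using t that by blast
qed

section \<open>Walks modulo a prime\<close>

text \<open>The orbits of \<open>h\<close> have \<open>1\<close> or \<open>L\<close> elements. This
  is applied to the rotation of lists of steps and to the conjugation of isomorphisms by a deck
  transformation.\<close>

lemma card_mod_prime_eq_card_fixpoints:
  fixes h :: "'b \<Rightarrow> 'b" and L :: nat
  assumes fin: "finite T" and L: "prime L"
    and maps: "\<And>x. x \<in> T \<Longrightarrow> h x \<in> T" and per: "\<And>x. x \<in> T \<Longrightarrow> (h ^^ L) x = x"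
  shows "[card T = card {x \<in> T. h x = x}] (mod L)"
proof -
  define orb where "orb x = (\<lambda>k. (h ^^ k) x) ` {..<L}" for x
  have L0: "L > 0" using prime_gt_0_nat[OF L] .
  have powT: "(h ^^ k) x \<in> T" if "x \<in> T" for x k
    using that by (induction k) (auto intro: maps)
  have orb: "orb x = range (\<lambda>k. (h ^^ k) x)" if x: "x \<in> T" for x
  proof
    show "range (\<lambda>k. (h ^^ k) x) \<subseteq> orb x"
    proof safe
      fix k
      have "(h ^^ k) x = (h ^^ (k mod L)) x" using funpow_mod_eq[OF per[OF x]] by metis
      then show "(h ^^ k) x \<in> orb x" using L0 by (auto simp: orb_def)
    qed
  qed (auto simp: orb_def)
  have orb_eq: "orb z = orb x" if x: "x \<in> T" and z: "z \<in> orb x" for x z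
  proof -
    have zT: "z \<in> T" using x z powT by (auto simp: orb_def)
    obtain i where i: "i < L" "z = (h ^^ i) x" using z by (auto simp: orb_def)
    have sub: "orb b \<subseteq> orb a" if "a \<in> T" "b \<in> T" "b = (h ^^ k) a" for a b k
    proof -
      have "(h ^^ n) b = (h ^^ (n + k)) a" for n using that(3) by (simp add: funpow_add)
      then show ?thesis using that by (auto simp: orb)
    qed
    have "(h ^^ (L - i)) z = (h ^^ (L - i + i)) x" by (simp only: i(2) funpow_add o_apply)
    then have "x = (h ^^ (L - i)) z" using i per[OF x] by simp
    then show ?thesis using sub x zT i by blast
  qed
  have card_orb: "card (orb x) = L" if x: "x \<in> T" and nf: "h x \<noteq> x" for x
  proof -
    \<comment> \<open>A period \<open>n\<close> below \<open>L\<close> is coprime to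
      \<open>L\<close>; with an inverse \<open>a\<close> of \<open>n\<close> modulo \<open>L\<close>
      it would follow that \<open>h x = x\<close>.\<close>
    have no: "(h ^^ n) x \<noteq> x" if n: "0 < n" "n < L" for n
    proof
      assume fx: "(h ^^ n) x = x"
      have "coprime n L"
        using n L by (metis coprime_commute nat_dvd_not_less prime_imp_coprime)
      then obtain a where a: "[n * a = Suc 0] (mod L)" using cong_solve_coprime_nat by blast
      have "(h ^^ (n * a)) x = x"
        using funpow_mod_eq[OF fx, of "n * a"] by simp
      then have "(h ^^ (n * a mod L)) x = x" using funpow_mod_eq[OF per[OF x]] by metis
      moreover have "n * a mod L = 1" using a prime_gt_1_nat[OF L] by (simp add: cong_def)
      ultimately show False using nf by simp
    qed
    have "(h ^^ i) x \<noteq> (h ^^ j) x" if ij: "i < j" "j < L" for i j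
    proof
      assume eq: "(h ^^ i) x = (h ^^ j) x"
      have "(h ^^ (j - i)) x = (h ^^ ((L - i + j) mod L)) x"
        using ij by (simp add: mod_if)
      also have "\<dots> = (h ^^ (L - i + j)) x" by (rule funpow_mod_eq[OF per[OF x]])
      also have "\<dots> = (h ^^ (L - i)) ((h ^^ i) x)" using eq by (simp add: funpow_add)
      also have "\<dots> = (h ^^ (L - i + i)) x" by (simp only: funpow_add o_apply)
      also have "\<dots> = x" using ij per[OF x] by simp
      finally show False using no[of "j - i"] ij by simp
    qed
    then have "inj_on (\<lambda>k. (h ^^ k) x) {..<L}"
      by (intro linorder_inj_onI) auto
    then show ?thesis by (simp add: orb_def card_image)
  qed
  let ?N = "{x \<in> T. h x \<noteq> x}" and ?F = "{x \<in> T. h x = x}"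
  have orbN: "z \<in> ?N" if x: "x \<in> ?N" and z: "z \<in> orb x" for x z
  proof -
    obtain i where i: "i < L" "z = (h ^^ i) x" using z by (auto simp: orb_def)
    have zT: "z \<in> T" using x i powT by simp
    have "h z \<noteq> z"
    proof
      assume "h z = z"
      then have "orb z = {z}"
      proof -
        have "(h ^^ k) z = z" for k using \<open>h z = z\<close> by (induction k) auto
        then show ?thesis using L0 by (auto simp: orb_def)
      qed
      then have "orb x = {z}" using orb_eq[of x z] x z by simp
      then have "card (orb x) = 1" by simp
      then show False using card_orb[of x] x prime_gt_1_nat[OF L] by simp
    qed
    then show ?thesis using zT by simp
  qed
  have self: "x \<in> orb x" for x using L0 by (auto simp: orb_def intro!: image_eqI[of _ _ 0])
  have un: "\<Union> (orb ` ?N) = ?N" using self orbN by blast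
  have "L dvd card (\<Union> (orb ` ?N))"
  proof (rule dvd_partition)
    show "finite (\<Union> (orb ` ?N))" unfolding un using fin by simp
    show "\<forall>c\<in>orb ` ?N. L dvd card c" using card_orb by auto
    show "\<forall>c1\<in>orb ` ?N. \<forall>c2\<in>orb ` ?N. c1 \<noteq> c2 \<longrightarrow> c1 \<inter> c2 = {}"
    proof (intro ballI impI)
      fix c1 c2 assume c: "c1 \<in> orb ` ?N" "c2 \<in> orb ` ?N" "c1 \<noteq> c2"
      then obtain x y where xy: "x \<in> T" "c1 = orb x" "y \<in> T" "c2 = orb y" by auto
      show "c1 \<inter> c2 = {}"
      proof (rule ccontr)
        assume "c1 \<inter> c2 \<noteq> {}"
        then obtain z where "z \<in> orb x" "z \<in> orb y" using xy by auto
        then have "orb x = orb y" using orb_eq xy by metis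
        then show False using c xy by simp
      qed
    qed
  qed
  then have "L dvd card ?N" by (simp only: un)
  moreover have "card T = card ?N + card ?F"
  proof -
    have "T = ?N \<union> ?F" by auto
    then show ?thesis using fin by (subst card_Un_disjoint[symmetric]) auto
  qed
  ultimately show ?thesis by (simp add: cong_def mod_add_eq dvd_eq_mod_eq_0 flip: mod_add_left_eq)
qed

section \<open>Walks as lists of steps\<close>

fun walks :: "int \<Rightarrow> ('a::{field,finite} \<Rightarrow> int) \<Rightarrow> nat \<Rightarrow> 'a \<times> int \<Rightarrow> 'a \<times> int \<Rightarrow> nat" where
  "walks l \<alpha> 0 v w = (if v = w then 1 else 0)"
| "walks l \<alpha> (Suc k) v w = (\<Sum>u\<in>verts l. if adj l \<alpha> v u then walks l \<alpha> k u w else 0)"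

lemma walks_graph_iso:
  assumes f: "graph_iso l \<alpha> \<beta> f" and "v \<in> verts l" "w \<in> verts l"
  shows "walks l \<beta> k (f v) (f w) = walks l \<alpha> k v w"
  using assms(2)
proof (induction k arbitrary: v)
  case 0
  then show ?case using f assms(3) by (auto simp: graph_iso_def bij_betw_def dest: inj_onD)
next
  case (Suc k)
  have bij: "bij_betw f (verts l) (verts l)" using f by (simp add: graph_iso_def)
  have "walks l \<beta> (Suc k) (f v) (f w) =
      (\<Sum>u\<in>verts l. if adj l \<beta> (f v) (f u) then walks l \<beta> k (f u) (f w) else 0)"
    using sum.reindex_bij_betw[OF bij, of "\<lambda>u. if adj l \<beta> (f v) u then walks l \<beta> k u (f w) else 0"]
    by simp
  also have "\<dots> = walks l \<alpha> (Suc k) v w"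
    using f Suc by (auto simp: graph_iso_def intro!: sum.cong)
  finally show ?case .
qed

text \<open>These are the ways to write \<open>(d, e)\<close> as an ordered sum of \<open>k\<close>
  elements of the connection set; their number is the coefficient of \<open>(d, e)\<close> in the
  \<open>k\<close>-th power of that set in the group ring.\<close>

definition step_lists :: "int \<Rightarrow> ('a::{field,finite} \<Rightarrow> int) \<Rightarrow> nat \<Rightarrow> 'a \<Rightarrow> int \<Rightarrow> 'a list set" where
  "step_lists l \<alpha> k d e =
     {ss. length ss = k \<and> set ss \<subseteq> nzsq \<and> sum_list ss = d \<and> sum_list (map \<alpha> ss) mod l = e mod l}"

lemma finite_step_lists: "finite (step_lists l \<alpha> k d e)"
  by (rule finite_subset[OF _ finite_lists_length_eq[of nzsq k]]) (auto simp: step_lists_def)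

lemma card_step_lists_Suc:
  "card (step_lists l \<alpha> (Suc k) d e) = (\<Sum>s\<in>nzsq. card (step_lists l \<alpha> k (d - s) (e - \<alpha> s)))"
proof -
  have mod: "(\<alpha> s + b) mod l = e mod l \<longleftrightarrow> b mod l = (e - \<alpha> s) mod l" for s b
    by (simp add: mod_eq_dvd_iff algebra_simps)
  have "step_lists l \<alpha> (Suc k) d e = (\<Union>s\<in>nzsq. (#) s ` step_lists l \<alpha> k (d - s) (e - \<alpha> s))"
    (is "?A = ?B")
  proof
    show "?A \<subseteq> ?B"
    proof
      fix ss assume ss: "ss \<in> ?A"
      then obtain s ss' where s: "ss = s # ss'" by (cases ss) (auto simp: step_lists_def)
      then have "s \<in> nzsq" "ss' \<in> step_lists l \<alpha> k (d - s) (e - \<alpha> s)"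
        using ss by (auto simp: step_lists_def mod)
      then show "ss \<in> ?B" using s by blast
    qed
    show "?B \<subseteq> ?A" by (auto simp: step_lists_def mod)
  qed
  also have "card \<dots> = (\<Sum>s\<in>nzsq. card ((#) s ` step_lists l \<alpha> k (d - s) (e - \<alpha> s)))"
    by (rule card_UN_disjoint) (auto simp: finite_step_lists)
  finally show ?thesis by (simp add: card_image)
qed

lemma walks_eq_card_step_lists:
  assumes l: "l > 0" and \<alpha>: "\<forall>s\<in>nzsq. \<alpha> s \<in> {0..<l}"
    and "i \<in> {0..<l}" and j: "j \<in> {0..<l}"
  shows "walks l \<alpha> k (x, i) (y, j) = card (step_lists l \<alpha> k (y - x) (j - i))"
  using assms(3)
proof (induction k arbitrary: x i)
  case 0
  have "(0::int) mod l = (j - i) mod l \<longleftrightarrow> i = j"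
  proof
    assume "0 mod l = (j - i) mod l"
    then have "[j = i] (mod l)" by (simp add: cong_iff_dvd_diff dvd_eq_mod_eq_0)
    then show "i = j" using 0 j by (auto dest: cong_less_imp_eq_int)
  qed simp
  then have "step_lists l \<alpha> 0 (y - x) (j - i) = (if (x, i) = (y, j) then {[]} else {})"
    by (auto simp: step_lists_def)
  then show ?case by simp
next
  case (Suc k)
  let ?g = "\<lambda>s. (x + s, (i + \<alpha> s) mod l)"
  have inj: "inj_on ?g nzsq" by (auto simp: inj_on_def)
  have adj: "{u \<in> verts l. adj l \<alpha> (x, i) u} = ?g ` nzsq"
  proof
    show "?g ` nzsq \<subseteq> {u \<in> verts l. adj l \<alpha> (x, i) u}"
      using l Suc.prems \<alpha> by (auto simp: verts_def adj_def mod_simps)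
    show "{u \<in> verts l. adj l \<alpha> (x, i) u} \<subseteq> ?g ` nzsq"
    proof
      fix u assume u: "u \<in> {u \<in> verts l. adj l \<alpha> (x, i) u}"
      then have "snd u = (i + (snd u - i) mod l) mod l"
        by (auto simp: verts_def mod_simps)
      then show "u \<in> ?g ` nzsq"
        using u by (intro image_eqI[of _ _ "fst u - x"]) (auto simp: adj_def prod_eq_iff)
    qed
  qed
  have fin: "finite (verts l :: ('a \<times> int) set)" by (simp add: verts_def)
  have "walks l \<alpha> (Suc k) (x, i) (y, j) = (\<Sum>u\<in>{u \<in> verts l. adj l \<alpha> (x, i) u}. walks l \<alpha> k u (y, j))"
    by (simp add: sum.inter_filter[OF fin])
  also have "\<dots> = (\<Sum>s\<in>nzsq. walks l \<alpha> k (?g s) (y, j))"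
    unfolding adj by (simp add: sum.reindex[OF inj])
  also have "\<dots> = (\<Sum>s\<in>nzsq. card (step_lists l \<alpha> k (y - x - s) (j - i - \<alpha> s)))"
  proof (rule sum.cong[OF refl])
    fix s
    have "walks l \<alpha> k (?g s) (y, j) = card (step_lists l \<alpha> k (y - (x + s)) (j - (i + \<alpha> s) mod l))"
      using l by (intro Suc.IH) simp
    also have "step_lists l \<alpha> k (y - (x + s)) (j - (i + \<alpha> s) mod l) =
        step_lists l \<alpha> k (y - x - s) (j - i - \<alpha> s)"
      by (simp add: step_lists_def mod_simps diff_diff_eq)
    finally show "walks l \<alpha> k (?g s) (y, j) = card (step_lists l \<alpha> k (y - x - s) (j - i - \<alpha> s))" .
  qed
  finally show ?case by (simp add: card_step_lists_Suc)
qed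

text \<open>Rotating the list of steps shows that modulo \<open>l\<close> only the constant walks count; this is the
  identity \<open>(\<Sum>s. s) ^ l = (\<Sum>s. s ^ l)\<close> in the group algebra over the field with \<open>l\<close> elements.\<close>

lemma card_step_lists_mod_prime:
  fixes \<alpha> :: "'a::{field,finite} \<Rightarrow> int"
  assumes L: "prime L" and ch: "\<not> CHAR('a) dvd L"
  shows "card (step_lists (int L) \<alpha> L d e) mod L =
    (if int L dvd e \<and> d \<in> (*) (of_nat L) ` nzsq then 1 else 0)"
proof -
  let ?T = "step_lists (int L) \<alpha> L d e"
  have L1: "L > 1" using prime_gt_1_nat[OF L] .
  have c0: "(of_nat L :: 'a) \<noteq> 0" using ch by (simp add: of_nat_eq_0_iff_char_dvd)
  have rot: "sum_list (rotate1 xs) = sum_list xs" for xs :: "'c::comm_monoid_add list"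
    by (cases xs) (simp_all add: add.commute)
  have "[card ?T = card {xs \<in> ?T. rotate1 xs = xs}] (mod L)"
  proof (rule card_mod_prime_eq_card_fixpoints[OF finite_step_lists L])
    fix xs assume xs: "xs \<in> ?T"
    then show "rotate1 xs \<in> ?T" by (simp add: step_lists_def rot flip: rotate1_map)
    show "(rotate1 ^^ L) xs = xs" using xs by (simp add: step_lists_def flip: rotate_def)
  qed
  moreover have "{xs \<in> ?T. rotate1 xs = xs} =
      (if int L dvd e \<and> d \<in> (*) (of_nat L) ` nzsq then {replicate L (d / of_nat L)} else {})"
    (is "?F = ?R")
  proof -
    \<comment> \<open>A list invariant under rotation is constant. Its entry \<open>s\<close>
      satisfies \<open>L * s = d\<close>, and \<open>L * \<alpha> s\<close> vanishes modulo
      \<open>L\<close>, so \<open>e\<close> must vanish as well.\<close>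
    have fixed: "xs = replicate L (d / of_nat L) \<and> int L dvd e \<and> d \<in> (*) (of_nat L) ` nzsq"
      if xs: "xs \<in> ?F" for xs
    proof -
      have len: "length xs = L" using xs by (simp add: step_lists_def)
      then have "card (set xs) = 1" using xs rotate1_fixpoint_card[of xs] L1 by auto
      then obtain s where s: "set xs = {s}" by (auto simp: card_1_singleton_iff)
      then have rep: "xs = replicate L s" using len by (metis replicate_eqI singletonD)
      then show ?thesis using xs s c0
        by (auto simp: step_lists_def sum_list_replicate dvd_eq_mod_eq_0 map_replicate)
    qed
    have "replicate L (d / of_nat L) \<in> ?F" if "int L dvd e" "d \<in> (*) (of_nat L) ` nzsq"
      using that c0 L1 by (auto simp: step_lists_def sum_list_replicate dvd_eq_mod_eq_0)
    then show ?thesis using fixed by auto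
  qed
  ultimately show ?thesis using L1 by (auto simp: cong_def)
qed

text \<open>The number of walks of length \<open>l\<close> from \<open>v\<close> to \<open>w\<close>
  is \<open>1\<close> modulo \<open>l\<close> if the displayed relation holds and \<open>0\<close>
  otherwise, and graph isomorphisms preserve it. The factor \<open>l\<close> comes from repeating a
  single step \<open>l\<close> times.\<close>

lemma graph_iso_preserves_scaled_slices:
  fixes \<alpha> \<beta> :: "'a::{field,finite} \<Rightarrow> int"
  assumes l: "prime l" and ch: "\<not> CHAR('a) dvd nat l"
    and \<alpha>: "voltage l \<alpha>" and \<beta>: "voltage l \<beta>" and f: "graph_iso l \<alpha> \<beta> f"
    and v: "v \<in> verts l" and w: "w \<in> verts l"
  shows "snd (f v) = snd (f w) \<and> fst (f w) - fst (f v) \<in> (*) (of_nat (nat l)) ` nzsq \<longleftrightarrow>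
    snd v = snd w \<and> fst w - fst v \<in> (*) (of_nat (nat l)) ` nzsq"
proof -
  have l0: "l > 0" using l by (simp add: prime_gt_0_int)
  define L where "L = nat l"
  have lL: "l = int L" using l0 by (simp add: L_def)
  have L: "prime L" using l lL by simp
  have key: "walks l \<gamma> L a b mod L = (if snd a = snd b \<and> fst b - fst a \<in> (*) (of_nat L) ` nzsq then 1 else 0)"
    if "voltage l \<gamma>" "a \<in> verts l" "b \<in> verts l" for \<gamma> and a b :: "'a \<times> int"
  proof -
    have dvd: "l dvd snd b - snd a \<longleftrightarrow> snd a = snd b"
    proof
      assume "l dvd snd b - snd a"
      then have "[snd b = snd a] (mod l)" by (simp add: cong_iff_dvd_diff)
      then show "snd a = snd b" using that by (auto simp: verts_def dest: cong_less_imp_eq_int)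
    qed simp
    have "walks l \<gamma> L a b = card (step_lists l \<gamma> L (fst b - fst a) (snd b - snd a))"
      using walks_eq_card_step_lists[OF l0, of \<gamma> "snd a" "snd b" L "fst a" "fst b"] that
      by (auto simp: voltage_def verts_def)
    then show ?thesis
      using card_step_lists_mod_prime[OF L, of \<gamma> "fst b - fst a" "snd b - snd a"] ch dvd
      by (simp add: lL)
  qed
  have fv: "f v \<in> verts l" "f w \<in> verts l"
    using f v w by (auto simp: graph_iso_def bij_betw_def)
  have "(if snd (f v) = snd (f w) \<and> fst (f w) - fst (f v) \<in> (*) (of_nat L) ` nzsq then 1 else 0::nat) =
      (if snd v = snd w \<and> fst w - fst v \<in> (*) (of_nat L) ` nzsq then 1 else 0)"
    by (simp only: key[OF \<alpha> v w, symmetric] key[OF \<beta> fv, symmetric] walks_graph_iso[OF f v w, of L])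
  then show ?thesis unfolding L_def by (metis zero_neq_one)
qed

section \<open>Sums of the quadratic character\<close>

lemma field_autD:
  assumes "field_aut \<sigma>"
  shows "bij \<sigma>" "\<sigma> (x + y) = \<sigma> x + \<sigma> y" "\<sigma> (x * y) = \<sigma> x * \<sigma> y" "\<sigma> 1 = 1"
  using assms by (simp_all add: field_aut_def)

lemma field_aut_zero: "field_aut \<sigma> \<Longrightarrow> \<sigma> 0 = 0"
  using field_autD(2)[of \<sigma> 0 0] by (metis add_0 add_cancel_right_right)

lemma field_aut_diff: "field_aut \<sigma> \<Longrightarrow> \<sigma> (x - y) = \<sigma> x - \<sigma> y"
  using field_autD(2)[of \<sigma> "x - y" y] by simp

lemma field_aut_eq_iff: "field_aut \<sigma> \<Longrightarrow> \<sigma> x = \<sigma> y \<longleftrightarrow> x = y"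
  using field_autD(1)[of \<sigma>] by (auto simp: bij_def inj_def)

lemma field_aut_eq_0_iff: "field_aut \<sigma> \<Longrightarrow> \<sigma> x = 0 \<longleftrightarrow> x = 0"
  using field_aut_eq_iff[of \<sigma> x 0] by (simp add: field_aut_zero)

lemma field_aut_divide:
  assumes "field_aut \<sigma>"
  shows "\<sigma> (x / y) = \<sigma> x / \<sigma> y"
proof (cases "y = 0")
  case False
  then have "\<sigma> (x / y) * \<sigma> y = \<sigma> x" using field_autD(3)[OF assms, of "x / y" y] by simp
  then show ?thesis using False field_aut_eq_0_iff[OF assms, of y] by (simp add: eq_divide_eq)
qed (simp add: field_aut_zero[OF assms])

lemma nzsq_mult_field_aut_iff:
  assumes "field_aut \<sigma>" and t: "t \<in> nzsq"
  shows "t * \<sigma> x \<in> nzsq \<longleftrightarrow> x \<in> nzsq"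
proof -
  obtain u where u: "t = u ^ 2" "u \<noteq> 0" using t by (auto simp: nzsq_def)
  have sq: "\<sigma> (y ^ 2) = \<sigma> y ^ 2" for y by (simp add: power2_eq_square field_autD[OF assms(1)])
  show ?thesis
  proof
    assume "t * \<sigma> x \<in> nzsq"
    then obtain y where y: "t * \<sigma> x = y ^ 2" "t * \<sigma> x \<noteq> 0" unfolding nzsq_def mem_Collect_eq by blast
    obtain z where z: "\<sigma> z = y / u" using field_autD(1)[OF assms(1)] by (metis bij_pointE)
    have "\<sigma> x = \<sigma> (z ^ 2)" using y u by (simp add: sq z power_divide field_simps)
    then have "x = z ^ 2" by (simp only: field_aut_eq_iff[OF assms(1)])
    moreover have "x \<noteq> 0" using y field_aut_zero[OF assms(1)] by auto
    ultimately show "x \<in> nzsq" by (auto simp: nzsq_def)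
  next
    assume "x \<in> nzsq"
    then obtain y where y: "x = y ^ 2" "x \<noteq> 0" by (auto simp: nzsq_def)
    then have "t * \<sigma> x = (u * \<sigma> y) ^ 2" by (simp add: u sq power_mult_distrib)
    moreover have "t * \<sigma> x \<noteq> 0" using y u field_aut_eq_0_iff[OF assms(1)] by simp
    ultimately show "t * \<sigma> x \<in> nzsq" by (auto simp: nzsq_def)
  qed
qed

section \<open>The quadratic character\<close>

definition quad_char :: "'a::field \<Rightarrow> int" where
  "quad_char x = (if x = 0 then 0 else if x \<in> nzsq then 1 else -1)"

lemma quad_char_0 [simp]: "quad_char 0 = 0"
  by (simp add: quad_char_def)

lemma quad_char_square: "x \<noteq> 0 \<Longrightarrow> quad_char x * quad_char x = 1"
  by (simp add: quad_char_def)

lemma one_neq_minus_one: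
  assumes "odd CARD('a::{field,finite})"
  shows "(1::'a) \<noteq> - 1"
proof
  obtain m where q: "CARD('a) = 2 * m + 1" using assms by (elim oddE)
  have m: "m > 0" using q card_field_gt_1[where 'a = 'a] by simp
  assume "(1::'a) = -1"
  then have "UNIV - {0} \<subseteq> (nzsq :: 'a set)"
    using power_half_card[OF q] nzsq_eq_power_half_card(1)[OF q] by auto
  then have "card (UNIV - {0::'a}) \<le> card (nzsq :: 'a set)" by (intro card_mono) simp_all
  then show False using nzsq_eq_power_half_card(2)[OF q] q m by simp
qed

lemma quad_char_mult:
  fixes x y :: "'a::{field,finite}"
  assumes "odd CARD('a)"
  shows "quad_char (x * y) = quad_char x * quad_char y"
proof (cases "x = 0 \<or> y = 0")
  case False
  obtain m where q: "CARD('a) = 2 * m + 1" using assms by (elim oddE)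
  note ne = one_neq_minus_one[OF assms]
  have "(if x * y \<in> nzsq then 1 else - 1) = (if x \<in> nzsq then 1 else - 1) * (if y \<in> nzsq then 1 else (- 1 :: 'a))"
    using False power_half_card[OF q, of x] power_half_card[OF q, of y] power_half_card[OF q, of "x * y"]
    by (simp add: power_mult_distrib)
  then show ?thesis using False ne by (auto simp: quad_char_def split: if_splits)
qed (auto simp: quad_char_def)

lemma sum_quad_char:
  assumes "odd CARD('a::{field,finite})"
  shows "(\<Sum>x\<in>(UNIV::'a set). quad_char x) = 0"
proof -
  obtain m where q: "CARD('a) = 2 * m + 1" using assms by (elim oddE)
  have sub: "nzsq \<subseteq> UNIV - {0::'a}" by (auto simp: nzsq_def)
  have "(\<Sum>x\<in>(UNIV::'a set). quad_char x) = (\<Sum>x\<in>UNIV - {0::'a}. quad_char x)"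
    by (rule sum.mono_neutral_right) auto
  also have "\<dots> = (\<Sum>x\<in>UNIV - {0::'a} - nzsq. quad_char x) + (\<Sum>x\<in>(nzsq::'a set). quad_char x)"
    by (rule sum.subset_diff[OF sub]) simp
  also have "\<dots> = (\<Sum>x\<in>UNIV - {0::'a} - nzsq. -1) + (\<Sum>x\<in>(nzsq::'a set). 1)"
    by (intro arg_cong2[where f = "(+)"] sum.cong) (auto simp: quad_char_def nzsq_def)
  also have "\<dots> = 0"
    using card_Diff_subset[OF _ sub] nzsq_eq_power_half_card(2)[OF q] q by simp
  finally show ?thesis .
qed

text \<open>For \<open>d \<noteq> 0\<close> the summand equals \<open>quad_char (1 + c / d)\<close>,
  and \<open>1 + c / d\<close> runs through all elements other than \<open>1\<close>. Over the whole
  field the character sums to \<open>0\<close>.\<close>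

lemma sum_quad_char_shift:
  fixes c :: "'a::{field,finite}"
  assumes odd: "odd CARD('a)" and c: "c \<noteq> 0"
  shows "(\<Sum>d\<in>UNIV. quad_char d * quad_char (d + c)) = - 1"
proof -
  have "(\<Sum>d\<in>UNIV. quad_char d * quad_char (d + c)) = (\<Sum>d\<in>UNIV - {0}. quad_char d * quad_char (d + c))"
    by (rule sum.mono_neutral_right) auto
  also have "\<dots> = (\<Sum>d\<in>UNIV - {0}. quad_char (1 + c / d))"
  proof (rule sum.cong[OF refl])
    fix d :: 'a assume d: "d \<in> UNIV - {0}"
    then have "quad_char (d + c) = quad_char (d * (1 + c / d))" by (simp add: distrib_left)
    then show "quad_char d * quad_char (d + c) = quad_char (1 + c / d)"
      using d quad_char_square[of d] by (simp add: quad_char_mult[OF odd] flip: mult.assoc)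
  qed
  also have "\<dots> = (\<Sum>e\<in>UNIV - {1::'a}. quad_char e)"
    by (rule sum.reindex_bij_witness[of _ "\<lambda>e. c / (e - 1)" "\<lambda>d. 1 + c / d"]) (use c in auto)
  also have "\<dots> = (\<Sum>e\<in>(UNIV::'a set). quad_char e) - quad_char (1::'a)"
    by (simp add: sum_diff1)
  also have "quad_char (1::'a) = 1" by (auto simp: quad_char_def nzsq_def intro: exI[of _ 1])
  finally show ?thesis using sum_quad_char[OF odd] by simp
qed

text \<open>Second moment of the character sums \<open>\<Sum>x. quad_char (d + A x)\<close> over all \<open>d\<close>: the coset \<open>c + range A\<close>
  consists of squares, hence contributes the maximal possible amount.\<close>

lemma additive_image_coset_in_nzsq_bound:
  fixes A :: "'a::{field,finite} \<Rightarrow> 'a"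
  assumes odd: "odd CARD('a)" and add: "\<And>x y. A (x + y) = A x + A y"
    and sq: "\<And>x. c + A x \<in> nzsq"
  shows "CARD('a) + card {x. A x = 0} \<le> card {x. A x = 0} ^ 2"
proof -
  define q where "q = int CARD('a)"
  define \<kappa> where "\<kappa> = int (card {x. A x = 0})"
  have q0: "q > 0" using card_field_gt_1[where 'a = 'a] by (simp add: q_def)
  have diff: "A (x - y) = A x - A y" for x y using add[of "x - y" y] by simp
  have fib: "int (card {y. A y = A x}) = \<kappa>" for x
    unfolding \<kappa>_def by (intro arg_cong[where f = int] bij_betw_same_card[of "\<lambda>y. y - x"] bij_betwI[of _ _ _ "\<lambda>y. y + x"])
      (auto simp: diff add)
  define S where "S d = (\<Sum>x\<in>UNIV. quad_char (d + A x))" for d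
  \<comment> \<open>Distinct shifts of the character have correlation \<open>-1\<close>, equal ones
    \<open>q - 1\<close>.\<close>
  have inner: "(\<Sum>d\<in>UNIV. quad_char (d + a) * quad_char (d + b)) = (if a = b then q else 0) - 1" for a b :: 'a
  proof -
    have "(\<Sum>d\<in>UNIV. quad_char (d + a) * quad_char (d + b)) = (\<Sum>d\<in>UNIV. quad_char d * quad_char (d + (b - a)))"
      by (rule sum.reindex_bij_witness[of _ "\<lambda>d. d - a" "\<lambda>d. d + a"]) (auto simp: algebra_simps)
    also have "\<dots> = (if a = b then q else 0) - 1"
    proof (cases "a = b")
      case True
      have "(\<Sum>d\<in>(UNIV::'a set). quad_char d * quad_char d) = (\<Sum>d\<in>UNIV - {0::'a}. 1)"
        by (rule sum.mono_neutral_cong_right) (auto simp: quad_char_square)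
      then show ?thesis using True card_field_gt_1[where 'a = 'a] by (simp add: q_def of_nat_diff)
    qed (simp add: sum_quad_char_shift[OF odd])
    finally show ?thesis .
  qed
  have "(\<Sum>d\<in>UNIV. S d * S d) = (\<Sum>d\<in>UNIV. \<Sum>x\<in>UNIV. \<Sum>y\<in>UNIV. quad_char (d + A x) * quad_char (d + A y))"
    by (simp add: S_def sum_product)
  also have "\<dots> = (\<Sum>x\<in>UNIV. \<Sum>d\<in>UNIV. \<Sum>y\<in>UNIV. quad_char (d + A x) * quad_char (d + A y))"
    by (rule sum.swap)
  also have "\<dots> = (\<Sum>x\<in>UNIV. \<Sum>y\<in>UNIV. \<Sum>d\<in>UNIV. quad_char (d + A x) * quad_char (d + A y))"
    by (intro sum.cong refl sum.swap)
  also have "\<dots> = (\<Sum>x\<in>UNIV. \<Sum>y\<in>UNIV. (if A y = A x then q else 0) - 1)"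
    by (intro sum.cong refl) (simp add: inner)
  also have "\<dots> = (\<Sum>x\<in>(UNIV::'a set). q * \<kappa> - q)"
  proof (rule sum.cong[OF refl])
    fix x
    have "(\<Sum>y\<in>UNIV. (if A y = A x then q else 0) - 1) = (\<Sum>y\<in>UNIV. if A y = A x then q else 0) - q"
      by (simp add: sum_subtractf q_def)
    also have "(\<Sum>y\<in>UNIV. if A y = A x then q else 0) = (\<Sum>y\<in>{y. A y = A x}. q)"
      by (simp add: sum.If_cases)
    also have "\<dots> = q * \<kappa>" using fib[of x] by (simp add: mult.commute)
    finally show "(\<Sum>y\<in>UNIV. (if A y = A x then q else 0) - 1) = q * \<kappa> - q" .
  qed
  also have "\<dots> = q * (q * \<kappa> - q)" by (simp add: q_def)
  finally have moment: "(\<Sum>d\<in>UNIV. S d * S d) = q * (q * \<kappa> - q)" .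
  have Sc: "S (c + A y) = q" for y
  proof -
    have "c + A y + A x \<in> nzsq" for x using sq[of "y + x"] by (simp add: add add.assoc)
    then have "quad_char (c + A y + A x) = 1" for x by (auto simp: quad_char_def nzsq_def)
    then show ?thesis by (simp add: S_def q_def)
  qed
  \<comment> \<open>Summing over \<open>y\<close> instead of over the coset counts each of its
    points \<open>\<kappa>\<close> times, which costs a factor \<open>\<kappa>\<close> in the
    comparison with the full second moment.\<close>
  have "q * (q * q) = (\<Sum>y\<in>UNIV. S (c + A y) * S (c + A y))"
    by (simp add: Sc q_def)
  also have "\<dots> = (\<Sum>d\<in>UNIV. \<Sum>y\<in>{y. c + A y = d}. S (c + A y) * S (c + A y))"
    using sum.group[of UNIV UNIV "\<lambda>y. c + A y" "\<lambda>y. S (c + A y) * S (c + A y)"] by simp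
  also have "\<dots> = (\<Sum>d\<in>UNIV. int (card {y. c + A y = d}) * (S d * S d))"
    by (intro sum.cong refl) simp
  also have "\<dots> \<le> (\<Sum>d\<in>UNIV. \<kappa> * (S d * S d))"
  proof (intro sum_mono mult_right_mono)
    fix d
    show "int (card {y. c + A y = d}) \<le> \<kappa>"
    proof (cases "\<exists>x. c + A x = d")
      case True
      then obtain x where "c + A x = d" by blast
      then have "{y. c + A y = d} = {y. A y = A x}" by auto
      then show ?thesis using fib[of x] by simp
    next
      case False
      then have "{y. c + A y = d} = {}" by blast
      then show ?thesis by (simp only:) (simp add: \<kappa>_def)
    qed
  qed simp
  also have "\<dots> = \<kappa> * (q * (q * \<kappa> - q))" by (simp add: moment flip: sum_distrib_left)
  finally have "q * (q * q) \<le> \<kappa> * (q * (q * \<kappa> - q))" .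
  then have "(q * q) * q \<le> (q * q) * (\<kappa> * \<kappa> - \<kappa>)" by (simp add: algebra_simps)
  then have "q \<le> \<kappa> * \<kappa> - \<kappa>" using q0 by (simp only: mult_le_cancel_left_pos mult_pos_pos)
  then have "int (CARD('a) + card {x. A x = 0}) \<le> int (card {x. A x = 0} ^ 2)"
    by (simp add: q_def \<kappa>_def power2_eq_square)
  then show ?thesis by (simp only: of_nat_le_iff)
qed

text \<open>Dividing by a nonzero element \<open>z\<close> of the kernel turns the kernel into the
  subfield \<open>F\<close> on which \<open>\<sigma>\<close> and \<open>\<sigma>'\<close> agree. If
  \<open>w\<close> lies outside \<open>F\<close>, then \<open>1\<close> and \<open>w\<close> are
  independent over \<open>F\<close>, so \<open>F \<times> F\<close> embeds into the field.\<close>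

lemma card_semilinear_kernel:
  fixes \<sigma> \<sigma>' :: "'a::{field,finite} \<Rightarrow> 'a"
  assumes \<sigma>: "field_aut \<sigma>" and \<sigma>': "field_aut \<sigma>'" and t: "t \<noteq> 0" "t' \<noteq> 0"
    and ne: "{x. t' * \<sigma>' x = t * \<sigma> x} \<noteq> UNIV"
  shows "card {x. t' * \<sigma>' x = t * \<sigma> x} ^ 2 \<le> CARD('a)"
proof (cases "\<exists>x. x \<noteq> 0 \<and> t' * \<sigma>' x = t * \<sigma> x")
  case True
  let ?K = "{x. t' * \<sigma>' x = t * \<sigma> x}"
  obtain z where z: "z \<noteq> 0" "t' * \<sigma>' z = t * \<sigma> z" using True by blast
  define F where "F = {u. \<sigma>' u = \<sigma> u}"
  have K: "z * u \<in> ?K \<longleftrightarrow> u \<in> F" for u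
  proof -
    have "t' * \<sigma>' (z * u) = (t * \<sigma> z) * \<sigma>' u"
      by (simp only: field_autD(3)[OF \<sigma>'] z(2)[symmetric] mult.assoc)
    moreover have "t * \<sigma> (z * u) = (t * \<sigma> z) * \<sigma> u"
      by (simp only: field_autD(3)[OF \<sigma>] mult.assoc)
    moreover have "t * \<sigma> z \<noteq> 0" using t z field_aut_eq_0_iff[OF \<sigma>] by simp
    ultimately show ?thesis by (simp add: F_def)
  qed
  have "bij_betw ((*) z) F ?K"
    by (rule bij_betwI[of _ _ _ "\<lambda>x. x / z"]) (use K z in \<open>auto simp flip: K\<close>)
  then have cardK: "card ?K = card F" by (simp add: bij_betw_same_card)
  have "F \<noteq> UNIV"
  proof
    assume "F = UNIV"
    then have "x \<in> ?K" for x using K[of "x / z"] z by simp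
    then show False using ne by blast
  qed
  then obtain w where w: "w \<notin> F" by blast
  have "inj_on (\<lambda>(a, b). a + b * w) (F \<times> F)"
  proof (rule inj_onI, clarsimp)
    fix a b a' b' assume F: "a \<in> F" "b \<in> F" "a' \<in> F" "b' \<in> F" and eq: "a + b * w = a' + b' * w"
    have "b = b'"
    proof (rule ccontr)
      assume "b \<noteq> b'"
      then have "w = (a' - a) / (b - b')" using eq by (simp add: field_simps)
      then have "w \<in> F" using F by (simp add: F_def field_aut_divide field_aut_diff \<sigma> \<sigma>')
      then show False using w by simp
    qed
    then show "a = a' \<and> b = b'" using eq by simp
  qed
  then have "card (F \<times> F) \<le> CARD('a)" by (rule card_inj_on_le) auto
  then show ?thesis using cardK by (simp add: card_cartesian_product power2_eq_square)
next
  case False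
  then have "{x. t' * \<sigma>' x = t * \<sigma> x} = {0}" using field_aut_zero[OF \<sigma>] field_aut_zero[OF \<sigma>'] by auto
  then show ?thesis using card_field_gt_1[where 'a = 'a] by simp
qed

text \<open>With \<open>q\<close> the order of the field, the second moment gives
  \<open>q + k \<le> k ^ 2\<close> for the size \<open>k\<close> of the kernel, which contradicts
  \<open>k ^ 2 \<le> q\<close>; so the kernel is the whole field. Evaluation at \<open>1\<close>
  then compares the factors.\<close>

lemma semilinear_difference_in_nzsq:
  fixes \<sigma> \<sigma>' :: "'a::{field,finite} \<Rightarrow> 'a"
  assumes odd: "odd CARD('a)" and \<sigma>: "field_aut \<sigma>" and \<sigma>': "field_aut \<sigma>'"
    and t: "t \<noteq> 0" "t' \<noteq> 0" and sq: "\<And>x. c + (t' * \<sigma>' x - t * \<sigma> x) \<in> nzsq"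
  shows "t' = t" and "\<sigma>' = \<sigma>"
proof -
  have "CARD('a) + card {x. t' * \<sigma>' x - t * \<sigma> x = 0} \<le> card {x. t' * \<sigma>' x - t * \<sigma> x = 0} ^ 2"
    by (rule additive_image_coset_in_nzsq_bound[OF odd _ sq])
      (use \<sigma> \<sigma>' in \<open>simp add: field_aut_def algebra_simps\<close>)
  then have big: "CARD('a) + card {x. t' * \<sigma>' x = t * \<sigma> x} \<le> card {x. t' * \<sigma>' x = t * \<sigma> x} ^ 2"
    by simp
  have "0 \<in> {x. t' * \<sigma>' x = t * \<sigma> x}" using field_aut_zero[OF \<sigma>] field_aut_zero[OF \<sigma>'] by auto
  then have "card {x. t' * \<sigma>' x = t * \<sigma> x} > 0" by (auto simp: card_gt_0_iff)
  then have "\<not> card {x. t' * \<sigma>' x = t * \<sigma> x} ^ 2 \<le> CARD('a)" using big by linarith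
  then have all: "{x. t' * \<sigma>' x = t * \<sigma> x} = UNIV"
    using card_semilinear_kernel[OF \<sigma> \<sigma>' t] by blast
  then have "t' * \<sigma>' 1 = t * \<sigma> 1" by blast
  then show tt: "t' = t" using \<sigma> \<sigma>' by (simp add: field_aut_def)
  show "\<sigma>' = \<sigma>"
  proof
    fix x
    have "x \<in> {x. t' * \<sigma>' x = t * \<sigma> x}" unfolding all by simp
    then show "\<sigma>' x = \<sigma> x" using tt t by simp
  qed
qed

section \<open>Isomorphisms commuting with translations\<close>

lemma graph_iso_comp:
  assumes "graph_iso l \<alpha> \<beta> f" "graph_iso l \<beta> \<gamma> g"
  shows "graph_iso l \<alpha> \<gamma> (g \<circ> f)"
proof -
  have "f v \<in> verts l" if "v \<in> verts l" for v
    using assms(1) that by (auto simp: graph_iso_def bij_betw_def)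
  then show ?thesis
    using assms by (auto simp: graph_iso_def intro: bij_betw_trans)
qed

lemma graph_iso_inv:
  assumes p: "f permutes verts l" and f: "graph_iso l \<alpha> \<beta> f"
  shows "graph_iso l \<beta> \<alpha> (inv_into UNIV f)"
  unfolding graph_iso_def
proof (intro conjI ballI)
  note p' = permutes_inv[OF p]
  show "bij_betw (inv_into UNIV f) (verts l) (verts l)" by (rule permutes_imp_bij[OF p'])
  fix v w :: "'a \<times> int" assume vw: "v \<in> verts l" "w \<in> verts l"
  then have "inv_into UNIV f v \<in> verts l" "inv_into UNIV f w \<in> verts l"
    using permutes_in_image[OF p'] by auto
  then have "adj l \<alpha> (inv_into UNIV f v) (inv_into UNIV f w) \<longleftrightarrow>
      adj l \<beta> (f (inv_into UNIV f v)) (f (inv_into UNIV f w))"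
    using f by (simp add: graph_iso_def)
  then show "adj l \<beta> v w \<longleftrightarrow> adj l \<alpha> (inv_into UNIV f v) (inv_into UNIV f w)"
    by (simp add: permutes_inverses[OF p])
qed

text \<open>The deck transformation by \<open>k\<close>, extended by the identity outside the vertex
  set so that it \<open>permutes\<close> the vertices as a total function.\<close>

definition fibre_rot :: "int \<Rightarrow> int \<Rightarrow> 'a \<times> int \<Rightarrow> 'a \<times> int" where
  "fibre_rot l k v = (if snd v \<in> {0..<l} then (fst v, (snd v + k) mod l) else v)"

lemma fibre_rot_add: "l > 0 \<Longrightarrow> fibre_rot l a (fibre_rot l b v) = fibre_rot l (a + b) v"
  by (simp add: fibre_rot_def mod_simps algebra_simps)

lemma fibre_rot_mod: "a mod l = b mod l \<Longrightarrow> fibre_rot l a = fibre_rot l b"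
  by (rule ext) (auto simp: fibre_rot_def intro: mod_add_cong)

lemma fibre_rot_0: "l > 0 \<Longrightarrow> fibre_rot l 0 = id"
  by (rule ext) (simp add: fibre_rot_def prod_eq_iff)

lemma fibre_rot_permutes:
  assumes "l > 0"
  shows "fibre_rot l k permutes verts l"
proof (rule bij_imp_permutes)
  show "bij_betw (fibre_rot l k) (verts l) (verts l :: ('b \<times> int) set)"
  proof (rule bij_betwI[where g = "fibre_rot l (- k)"])
    fix v :: "'b \<times> int"
    show "fibre_rot l (- k) (fibre_rot l k v) = v" "fibre_rot l k (fibre_rot l (- k) v) = v"
      using assms by (simp_all add: fibre_rot_add fibre_rot_0)
  qed (use assms in \<open>auto simp: verts_def fibre_rot_def\<close>)
qed (auto simp: verts_def fibre_rot_def)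

lemma fibre_rot_graph_iso:
  assumes "l > 0"
  shows "graph_iso l \<alpha> \<alpha> (fibre_rot l k)"
  unfolding graph_iso_def
  using permutes_imp_bij[OF fibre_rot_permutes[OF assms]] assms
  by (auto simp: verts_def adj_def fibre_rot_def mod_simps)

text \<open>On vertices these are the maps \<open>(x, i) \<mapsto> (c i + x, \<pi> i)\<close> with
  \<open>\<pi> 0 = 0\<close>. Since \<open>permutes\<close> fixes everything outside the vertices,
  they form a finite group under composition.\<close>

definition shears :: "int \<Rightarrow> ('a::{field,finite} \<times> int \<Rightarrow> 'a \<times> int) set" where
  "shears l = {g. g permutes verts l \<and>
     (\<forall>x y. \<forall>i\<in>{0..<l}. g (x + y, i) = (fst (g (x, i)) + y, snd (g (x, i)))) \<and> snd (g (0, 0)) = 0}"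

lemma shearsD:
  assumes "g \<in> shears l"
  shows "g permutes verts l" and "i \<in> {0..<l} \<Longrightarrow> g (x + y, i) = (fst (g (x, i)) + y, snd (g (x, i)))"
    and "snd (g (0, 0)) = 0" and "i \<in> {0..<l} \<Longrightarrow> g (x, i) = (fst (g (0, i)) + x, snd (g (0, i)))"
    and "i \<in> {0..<l} \<Longrightarrow> snd (g (x, i)) \<in> {0..<l}"
proof -
  show p: "g permutes verts l" and eqv: "\<And>i x y. i \<in> {0..<l} \<Longrightarrow> g (x + y, i) = (fst (g (x, i)) + y, snd (g (x, i)))"
    and "snd (g (0, 0)) = 0"
    using assms by (auto simp: shears_def)
  show "i \<in> {0..<l} \<Longrightarrow> g (x, i) = (fst (g (0, i)) + x, snd (g (0, i)))" using eqv[of i 0 x] by simp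
  show "i \<in> {0..<l} \<Longrightarrow> snd (g (x, i)) \<in> {0..<l}"
    using permutes_in_image[OF p, of "(x, i)"] by (auto simp: verts_def)
qed

lemma id_in_shears: "id \<in> shears l"
  by (simp add: shears_def permutes_id)

lemma shears_comp:
  assumes "l > 0" and g: "g \<in> shears l" and h: "h \<in> shears l"
  shows "g \<circ> h \<in> shears l"
  unfolding shears_def
proof (intro CollectI conjI allI ballI)
  show "g \<circ> h permutes verts l" using shearsD(1)[OF g] shearsD(1)[OF h] by (rule permutes_compose[rotated])
  fix x y i assume i: "i \<in> {0..<l}"
  show "(g \<circ> h) (x + y, i) = (fst ((g \<circ> h) (x, i)) + y, snd ((g \<circ> h) (x, i)))"
    using shearsD(2)[OF h i, of x y] shearsD(2)[OF g shearsD(5)[OF h i], of "fst (h (x, i))" y x]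
    by simp
next
  show "snd ((g \<circ> h) (0, 0)) = 0"
    using shearsD(4)[OF g, of 0 "fst (h (0, 0))"] shearsD(3)[OF g] shearsD(3)[OF h] assms(1)
    by (cases "h (0, 0)") simp
qed

lemma shears_inv:
  assumes l: "l > 0" and g: "g \<in> shears l"
  shows "inv_into UNIV g \<in> shears l"
  unfolding shears_def
proof (intro CollectI conjI allI ballI)
  let ?g' = "inv_into UNIV g"
  note p = shearsD(1)[OF g]
  show p': "?g' permutes verts l" by (rule permutes_inv[OF p])
  fix x y i assume i: "i \<in> {0..<l}"
  obtain x' i' where x': "?g' (x, i) = (x', i')" by fastforce
  then have gx: "g (x', i') = (x, i)" using permutes_inverses(1)[OF p, of "(x, i)"] by simp
  have "i' \<in> {0..<l}" using permutes_in_image[OF p', of "(x, i)"] i x' by (auto simp: verts_def)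
  then have "g (x' + y, i') = (x + y, i)" using shearsD(2)[OF g, of i' x' y] gx by simp
  then have "?g' (x + y, i) = (x' + y, i')" using permutes_inverses(2)[OF p] by metis
  then show "?g' (x + y, i) = (fst (?g' (x, i)) + y, snd (?g' (x, i)))" using x' by simp
next
  let ?g' = "inv_into UNIV g"
  note p = shearsD(1)[OF g]
  have "g (- fst (g (0, 0)), 0) = (0, 0)"
    using shearsD(4)[OF g, of 0 "- fst (g (0, 0))"] shearsD(3)[OF g] l by simp
  then have "?g' (0, 0) = (- fst (g (0, 0)), 0)" using permutes_inverses(2)[OF p] by metis
  then show "snd (?g' (0, 0)) = 0" by simp
qed

section \<open>The group of shears and its order\<close>

abbreviation shear_group :: "int \<Rightarrow> ('a::{field,finite} \<times> int \<Rightarrow> 'a \<times> int) monoid" where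
  "shear_group l \<equiv> \<lparr>carrier = shears l, mult = (\<circ>), one = id\<rparr>"

lemma group_shear_group:
  assumes l: "l > 0"
  shows "group (shear_group l :: ('a::{field,finite} \<times> int \<Rightarrow> 'a \<times> int) monoid)"
proof (rule groupI)
  fix g :: "'a \<times> int \<Rightarrow> 'a \<times> int" assume "g \<in> carrier (shear_group l)"
  then have g: "g \<in> shears l" by simp
  have "inv_into UNIV g \<circ> g = id" by (rule permutes_inv_o(2)[OF shearsD(1)[OF g]])
  then show "\<exists>h\<in>carrier (shear_group l). h \<otimes>\<^bsub>shear_group l\<^esub> g = \<one>\<^bsub>shear_group l\<^esub>"
    using shears_inv[OF l g] by auto
qed (simp_all add: shears_comp[OF l] id_in_shears comp_assoc)

lemma inv_shear_group:
  assumes l: "l > 0" and g: "g \<in> shears l"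
  shows "m_inv (shear_group l) g = inv_into UNIV g"
  using group.inv_equality[OF group_shear_group[OF l], of "inv_into UNIV g" g]
    permutes_inv_o(2)[OF shearsD(1)[OF g]] shears_inv[OF l g] g by simp

text \<open>A shear amounts to a translation for each of the \<open>l\<close> slices and a
  permutation of the \<open>l - 1\<close> slices other than the one over \<open>0\<close>;
  \<open>F\<close> and \<open>G\<close> convert between the two forms.\<close>

lemma card_shears:
  assumes l: "l > 0"
  shows "card (shears l :: ('a::{field,finite} \<times> int \<Rightarrow> 'a \<times> int) set) = CARD('a) ^ nat l * fact (nat (l - 1))"
proof -
  let ?I = "{0..<l}" and ?C = "{0..<l} \<rightarrow>\<^sub>E (UNIV::'a set)" and ?P = "{\<pi>. \<pi> permutes {1..<l}}"
  define F :: "('a \<times> int \<Rightarrow> 'a \<times> int) \<Rightarrow> (int \<Rightarrow> 'a) \<times> (int \<Rightarrow> int)" where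
    "F g = (restrict (\<lambda>i. fst (g (0, i))) ?I, \<lambda>i. if i \<in> {1..<l} then snd (g (0, i)) else i)" for g
  define G :: "(int \<Rightarrow> 'a) \<times> (int \<Rightarrow> int) \<Rightarrow> 'a \<times> int \<Rightarrow> 'a \<times> int" where
    "G = (\<lambda>(c, \<pi>) (x, i). if i \<in> ?I then (c i + x, \<pi> i) else (x, i))"
  have "bij_betw F (shears l) (?C \<times> ?P)"
  proof (rule bij_betwI[where g = G])
    show "F \<in> shears l \<rightarrow> ?C \<times> ?P"
    proof
      fix g :: "'a \<times> int \<Rightarrow> 'a \<times> int" assume g: "g \<in> shears l"
      let ?\<pi> = "\<lambda>i. if i \<in> {1..<l} then snd (g (0, i)) else i"
      have inj: "i = j" if ij: "i \<in> ?I" "j \<in> ?I" "snd (g (0, i)) = snd (g (0, j))" for i j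
      proof -
        have "g (fst (g (0, i)) - fst (g (0, j)), j) = g (0, i)"
          using shearsD(4)[OF g ij(2), of "fst (g (0, i)) - fst (g (0, j))"] ij(3) by (simp add: prod_eq_iff)
        from injD[OF permutes_inj[OF shearsD(1)[OF g]] this] show ?thesis by simp
      qed
      have "?\<pi> permutes {1..<l}"
      proof (rule bij_imp_permutes)
        have sub: "?\<pi> ` {1..<l} \<subseteq> {1..<l}"
        proof
          fix j assume "j \<in> ?\<pi> ` {1..<l}"
          then obtain i where i: "i \<in> {1..<l}" "j = snd (g (0, i))" by auto
          then have "j \<noteq> 0" using inj[of i 0] shearsD(3)[OF g] by auto
          moreover have "j \<in> ?I" using shearsD(5)[OF g, of i 0] i by auto
          ultimately show "j \<in> {1..<l}" by auto
        qed
        have "inj_on ?\<pi> {1..<l}" by (rule inj_onI) (auto intro: inj)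
        then show "bij_betw ?\<pi> {1..<l} {1..<l}"
          using endo_inj_surj[OF _ sub] by (simp add: bij_betw_def)
      qed auto
      then show "F g \<in> ?C \<times> ?P" by (auto simp: F_def)
    qed
    show "G \<in> ?C \<times> ?P \<rightarrow> shears l"
    proof
      fix c\<pi> assume "c\<pi> \<in> ?C \<times> ?P"
      then obtain c \<pi> where c\<pi>: "c\<pi> = (c, \<pi>)" and \<pi>: "\<pi> permutes {1..<l}" by auto
      have \<pi>0: "\<pi> permutes ?I" by (rule permutes_subset[OF \<pi>]) auto
      have img: "\<pi> i \<in> ?I \<longleftrightarrow> i \<in> ?I" for i by (rule permutes_in_image[OF \<pi>0])
      note \<pi>' = permutes_inverses[OF \<pi>0]
      have img': "inv_into UNIV \<pi> i \<in> ?I \<longleftrightarrow> i \<in> ?I" for i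
        by (rule permutes_in_image[OF permutes_inv[OF \<pi>0]])
      have "G (c, \<pi>) permutes verts l"
      proof (rule bij_imp_permutes)
        show "bij_betw (G (c, \<pi>)) (verts l) (verts l)"
          by (rule bij_betwI[where g = "\<lambda>(x, i). (x - c (inv_into UNIV \<pi> i), inv_into UNIV \<pi> i)"])
            (auto simp: G_def verts_def \<pi>' img[simplified] img'[simplified])
      qed (auto simp: G_def verts_def split: if_splits)
      moreover have "\<pi> 0 = 0" using \<pi> by (simp add: permutes_not_in)
      ultimately show "G c\<pi> \<in> shears l"
        using l by (auto simp: c\<pi> shears_def G_def)
    qed
    fix g :: "'a \<times> int \<Rightarrow> 'a \<times> int" assume g: "g \<in> shears l"
    show "G (F g) = g"
    proof
      fix v :: "'a \<times> int"
      obtain x i where v: "v = (x, i)" by fastforce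
      show "G (F g) v = g v"
      proof (cases "i \<in> ?I")
        case True
        have "(if i \<in> {1..<l} then snd (g (0, i)) else i) = snd (g (0, i))"
          using shearsD(3)[OF g] True by (cases "i = 0") auto
        then show ?thesis using shearsD(4)[OF g True, of x] True by (simp add: v F_def G_def)
      next
        case False
        then have "g v = v" using permutes_not_in[OF shearsD(1)[OF g], of v] by (simp add: v verts_def)
        then show ?thesis using False by (auto simp: v F_def G_def)
      qed
    qed
  next
    fix c\<pi> assume "c\<pi> \<in> ?C \<times> ?P"
    then obtain c \<pi> where c\<pi>: "c\<pi> = (c, \<pi>)" and c: "c \<in> ?C" and \<pi>: "\<pi> permutes {1..<l}" by auto
    have "restrict (\<lambda>i. fst (G c\<pi> (0, i))) ?I = c"
      using c by (auto simp: c\<pi> G_def fun_eq_iff PiE_def extensional_def)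
    moreover have "(\<lambda>i. if i \<in> {1..<l} then snd (G c\<pi> (0, i)) else i) = \<pi>"
      using permutes_not_in[OF \<pi>] by (auto simp: c\<pi> G_def fun_eq_iff)
    ultimately have "F (G c\<pi>) = (c, \<pi>)" by (simp only: F_def)
    then show "F (G c\<pi>) = c\<pi>" by (simp only: c\<pi>)
  qed
  then have "card (shears l :: ('a \<times> int \<Rightarrow> 'a \<times> int) set) = card (?C \<times> ?P)"
    by (rule bij_betw_same_card)
  also have "\<dots> = CARD('a) ^ nat l * fact (nat (l - 1))"
    by (simp add: card_cartesian_product card_PiE card_permutations[OF refl])
  finally show ?thesis .
qed

text \<open>The isomorphisms form the coset \<open>h \<circ> ?A\<close> of the automorphisms among
  the shears, so by Lagrange their number divides the order of the shear group. Fixing the slice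
  over \<open>0\<close> is what gives the factorial of \<open>l - 1\<close> instead of that of
  \<open>l\<close>, hence an order prime to \<open>l\<close>.\<close>

lemma prime_not_dvd_card_shear_isos:
  fixes \<alpha> \<beta> :: "'a::{field,finite} \<Rightarrow> int"
  assumes l: "prime l" and q: "\<not> nat l dvd CARD('a)"
    and h: "h \<in> shears l" "graph_iso l \<alpha> \<beta> h"
  shows "\<not> nat l dvd card {g \<in> shears l. graph_iso l \<alpha> \<beta> g}"
proof -
  have l0: "l > 0" using l by (simp add: prime_gt_0_int)
  let ?A = "{g \<in> shears l. graph_iso l \<alpha> \<alpha> g}" and ?H = "{g \<in> shears l. graph_iso l \<alpha> \<beta> g}"
  let ?G = "shear_group l :: ('a \<times> int \<Rightarrow> 'a \<times> int) monoid"
  interpret group ?G by (rule group_shear_group[OF l0])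
  note hp = shearsD(1)[OF h(1)]
  have "subgroup ?A ?G"
  proof (rule subgroupI)
    have "id \<in> ?A" using id_in_shears by (simp add: graph_iso_def)
    then show "?A \<noteq> {}" by blast
    fix a b assume a: "a \<in> ?A" and b: "b \<in> ?A"
    show "a \<otimes>\<^bsub>?G\<^esub> b \<in> ?A"
      using a b shears_comp[OF l0, of a b] graph_iso_comp[of l \<alpha> \<alpha> b \<alpha> a] by simp
    show "m_inv ?G a \<in> ?A"
      using a inv_shear_group[OF l0, of a] shears_inv[OF l0, of a] graph_iso_inv[of a l \<alpha> \<alpha>] shearsD(1)[of a l] by simp
  qed auto
  from lagrange[OF this, symmetric] have "card ?A dvd order ?G" by simp
  moreover have "order ?G = CARD('a) ^ nat l * fact (nat (l - 1))"
    using card_shears[OF l0] by (simp add: order_def)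
  moreover have "\<not> nat l dvd CARD('a) ^ nat l * fact (nat (l - 1))"
  proof
    have pr: "prime (nat l)" using l by simp
    assume "nat l dvd CARD('a) ^ nat l * fact (nat (l - 1))"
    then have "nat l dvd CARD('a) ^ nat l \<or> nat l dvd fact (nat (l - 1))"
      using prime_dvd_mult_iff[OF pr] by blast
    then show False
      using q l0 prime_dvd_power[OF pr] prime_dvd_fact_iff[OF pr] by auto
  qed
  ultimately have A: "\<not> nat l dvd card ?A" using dvd_trans[of "nat l" "card ?A" "order ?G"] by auto
  have "bij_betw (\<lambda>g. h \<circ> g) ?A ?H"
  proof (rule bij_betwI[where g = "\<lambda>g. inv_into UNIV h \<circ> g"])
    show "(\<lambda>g. h \<circ> g) \<in> ?A \<rightarrow> ?H"
      using h shears_comp[OF l0] graph_iso_comp by blast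
    show "(\<lambda>g. inv_into UNIV h \<circ> g) \<in> ?H \<rightarrow> ?A"
      using h shears_comp[OF l0] shears_inv[OF l0] graph_iso_comp graph_iso_inv[OF hp] by blast
  qed (simp_all add: permutes_inv_o[OF hp] flip: comp_assoc)
  from bij_betw_same_card[OF this] A show ?thesis by simp
qed

text \<open>Conjugation by the deck transformation, renormalised to fix the slice over \<open>0\<close>, acts on the
  isomorphisms with period \<open>l\<close>; its fixed points normalise the deck group.\<close>

lemma shear_iso_imp_voltages_proportional:
  fixes \<alpha> \<beta> :: "'a::{field,finite} \<Rightarrow> int"
  assumes l: "prime l" and q: "\<not> nat l dvd CARD('a)" and \<alpha>: "\<forall>s\<in>nzsq. \<alpha> s \<in> {0..<l}"
    and h: "h \<in> shears l" "graph_iso l \<alpha> \<beta> h"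
  obtains n where "n \<in> {1..<l}" "\<And>s. s \<in> nzsq \<Longrightarrow> (n * \<alpha> s) mod l = \<beta> s"
proof -
  have l1: "l > 1" using l by (simp add: prime_gt_1_int)
  then have l0: "l > 0" by simp
  let ?H = "{g \<in> shears l. graph_iso l \<alpha> \<beta> g}"
  \<comment> \<open>After the inner rotation, \<open>g\<close> sends the slice over \<open>0\<close>
    to the one of index \<open>snd (g (0, 1))\<close>; the outer rotation brings it back, so that
    \<open>T g\<close> is again a shear.\<close>
  define T :: "('a \<times> int \<Rightarrow> 'a \<times> int) \<Rightarrow> 'a \<times> int \<Rightarrow> 'a \<times> int" where
    "T g = fibre_rot l (- snd (g (0, 1))) \<circ> g \<circ> fibre_rot l 1" for g
  have TH: "T g \<in> ?H" if gH: "g \<in> ?H" for g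
  proof -
    have g: "g \<in> shears l" "graph_iso l \<alpha> \<beta> g" using gH by auto
    have iso: "graph_iso l \<alpha> \<beta> (T g)"
      unfolding T_def using g(2) fibre_rot_graph_iso[OF l0] by (intro graph_iso_comp) auto
    have perm: "T g permutes verts l"
      unfolding T_def by (intro permutes_compose fibre_rot_permutes[OF l0] shearsD(1)[OF g(1)])
    have Tg: "T g (x, i) = (fst (g (x, (i + 1) mod l)), (snd (g (x, (i + 1) mod l)) - snd (g (0, 1))) mod l)"
      if "i \<in> {0..<l}" for x i
      using that l0 shearsD(5)[OF g(1), of "(i + 1) mod l" x] by (simp add: T_def fibre_rot_def)
    have "T g (x + y, i) = (fst (T g (x, i)) + y, snd (T g (x, i)))" if i: "i \<in> {0..<l}" for x y i
      unfolding Tg[OF i] using l0 shearsD(2)[OF g(1), of "(i + 1) mod l" x y] by simp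
    moreover have "snd (T g (0, 0)) = 0" using Tg[of 0 0] l1 by simp
    ultimately show ?thesis using iso perm by (simp add: shears_def)
  qed
  \<comment> \<open>The successive corrections telescope, so the \<open>k\<close>-th iterate needs
    only the correction belonging to rotation by \<open>k\<close>; for \<open>k = l\<close> both
    rotations are trivial.\<close>
  have Tpow: "(T ^^ k) g = fibre_rot l (- snd (g (0, int k mod l))) \<circ> g \<circ> fibre_rot l (int k)"
    if gH: "g \<in> ?H" for g k
  proof (induction k)
    case 0
    have "snd (g (0, 0)) = 0" using gH shearsD(3) by blast
    then show ?case by (simp add: fibre_rot_0[OF l0])
  next
    case (Suc k)
    have g: "g \<in> shears l" using gH by simp
    let ?a = "snd (g (0, int k mod l))" and ?b = "snd (g (0, int (Suc k) mod l))"
    have eq: "(1 + int k) mod l = int (Suc k) mod l" by (simp add: add.commute)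
    have "?b \<in> {0..<l}" using shearsD(5)[OF g, of "int (Suc k) mod l" 0] l0 by simp
    then have "snd ((fibre_rot l (- ?a) \<circ> g \<circ> fibre_rot l (int k)) (0, 1)) = (?b - ?a) mod l"
      using l1 by (simp add: fibre_rot_def eq del: of_nat_Suc)
    then have "T (fibre_rot l (- ?a) \<circ> g \<circ> fibre_rot l (int k)) = fibre_rot l (- ((?b - ?a) mod l)) \<circ>
        (fibre_rot l (- ?a) \<circ> g \<circ> fibre_rot l (int k)) \<circ> fibre_rot l 1"
      by (simp only: T_def)
    moreover have "(T ^^ Suc k) g = T (fibre_rot l (- ?a) \<circ> g \<circ> fibre_rot l (int k))"
      by (simp only: funpow.simps comp_apply[of T] Suc)
    ultimately have "(T ^^ Suc k) g = fibre_rot l (- ((?b - ?a) mod l)) \<circ>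
        (fibre_rot l (- ?a) \<circ> g \<circ> fibre_rot l (int k)) \<circ> fibre_rot l 1"
      by (simp only:)
    also have "\<dots> = fibre_rot l (- ((?b - ?a) mod l) + - ?a) \<circ> g \<circ> fibre_rot l (int k + 1)"
      by (rule ext) (simp add: fibre_rot_add[OF l0] del: add_uminus_conv_diff)
    also have "fibre_rot l (- ((?b - ?a) mod l) + - ?a) = (fibre_rot l (- ?b) :: 'a \<times> int \<Rightarrow> 'a \<times> int)"
    proof (rule fibre_rot_mod)
      have "l dvd (?b - ?a) - (?b - ?a) mod l" by (rule dvd_minus_mod)
      moreover have "(?b - ?a) - (?b - ?a) mod l = (- ((?b - ?a) mod l) + - ?a) - (- ?b)" by simp
      ultimately show "(- ((?b - ?a) mod l) + - ?a) mod l = (- ?b) mod l"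
        by (simp only: mod_eq_dvd_iff)
    qed
    finally show ?case by (simp add: add.commute)
  qed
  have "[card ?H = card {g \<in> ?H. T g = g}] (mod nat l)"
  proof (rule card_mod_prime_eq_card_fixpoints[OF _ _ TH])
    have "finite (shears l :: ('a \<times> int \<Rightarrow> 'a \<times> int) set)"
      by (rule card_ge_0_finite) (simp add: card_shears[OF l0] zero_less_card_finite)
    then show "finite ?H" by simp
    show "prime (nat l)" using l by simp
    fix g assume gH: "g \<in> ?H"
    have "snd (g (0, 0)) = 0" using gH shearsD(3) by blast
    moreover have "fibre_rot l l = (fibre_rot l 0 :: 'a \<times> int \<Rightarrow> 'a \<times> int)" by (rule fibre_rot_mod) simp
    ultimately show "(T ^^ nat l) g = g"
      using Tpow[OF gH, of "nat l"] l0 by (simp add: fibre_rot_0[OF l0])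
  qed
  then have "\<not> nat l dvd card {g \<in> ?H. T g = g}"
    using prime_not_dvd_card_shear_isos[OF l q h] by (simp add: cong_dvd_iff)
  then have "{g \<in> ?H. T g = g} \<noteq> {}" by (metis card.empty dvd_0_right)
  then obtain g where g: "g \<in> shears l" "graph_iso l \<alpha> \<beta> g" and fixed: "T g = g" by blast
  define n where "n = snd (g (0, 1))"
  \<comment> \<open>The equation \<open>T g = g\<close> says that passing to the next slice keeps
    the translation part and adds \<open>n\<close> to the index of the image, so \<open>g\<close> is
    linear in \<open>i\<close>.\<close>
  have step: "g (0, (i + 1) mod l) = (fst (g (0, i)), (snd (g (0, i)) + n) mod l)" if i: "i \<in> {0..<l}" for i
  proof -
    have i': "(i + 1) mod l \<in> {0..<l}" using l0 by simp
    have "g (0, i) = (fst (g (0, (i + 1) mod l)), (snd (g (0, (i + 1) mod l)) - n) mod l)"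
      using arg_cong[OF fixed, of "\<lambda>g. g (0, i)"] i i' shearsD(5)[OF g(1) i', of 0]
      by (simp add: T_def fibre_rot_def n_def)
    then have "fst (g (0, i)) = fst (g (0, (i + 1) mod l))"
      "snd (g (0, i)) = (snd (g (0, (i + 1) mod l)) - n) mod l"
      by (metis fst_conv, metis snd_conv)
    then show ?thesis using shearsD(5)[OF g(1) i', of 0] by (simp add: prod_eq_iff mod_simps)
  qed
  define c where "c = fst (g (0, 0))"
  have lin: "g (0, int k) = (c, (n * int k) mod l)" if "int k < l" for k
    using that
  proof (induction k)
    case 0
    then show ?case using shearsD(3)[OF g(1)] by (simp add: c_def prod_eq_iff)
  next
    case (Suc k)
    then show ?case using step[of "int k"] by (simp add: mod_simps algebra_simps)
  qed
  have lin': "g (x, i) = (c + x, (n * i) mod l)" if i: "i \<in> {0..<l}" for x i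
    using lin[of "nat i"] shearsD(4)[OF g(1) i, of x] i by simp
  have "n \<in> {0..<l}" using shearsD(5)[OF g(1), of 1 0] l1 by (simp add: n_def)
  moreover have "n \<noteq> 0"
  proof
    assume "n = 0"
    then have "g (0, 1) = g (0, 0)" using lin'[of 0 0] lin'[of 1 0] l1 by simp
    from injD[OF permutes_inj[OF shearsD(1)[OF g(1)]] this] show False by simp
  qed
  ultimately have "n \<in> {1..<l}" by auto
  \<comment> \<open>The image of the edge from \<open>(0, 0)\<close> to
    \<open>(s, \<alpha> s)\<close> runs from \<open>(c, 0)\<close> to
    \<open>(c + s, (n * \<alpha> s) mod l)\<close>, from which \<open>\<beta> s\<close> is read
    off.\<close>
  moreover have "(n * \<alpha> s) mod l = \<beta> s" if s: "s \<in> nzsq" for s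
  proof -
    have as: "\<alpha> s \<in> {0..<l}" using \<alpha> s by blast
    then have "adj l \<alpha> (0, 0) (s, \<alpha> s)" using s l0 by (simp add: adj_def)
    then have "adj l \<beta> (g (0, 0)) (g (s, \<alpha> s))"
      using g(2) as l0 by (simp add: graph_iso_def verts_def)
    then show ?thesis using lin'[OF as, of s] lin'[of 0 0] l0 by (simp add: adj_def)
  qed
  ultimately show ?thesis by (rule that)
qed

section \<open>Isomorphisms of the covers\<close>

lemma graph_iso_cong:
  assumes "\<And>v. v \<in> verts l \<Longrightarrow> f v = g v" and "graph_iso l \<alpha> \<beta> f"
  shows "graph_iso l \<alpha> \<beta> g"
  using assms bij_betw_cong[of "verts l" f g "verts l"] by (simp add: graph_iso_def)

lemma minus_one_in_nzsq:
  assumes "CARD('a::{field,finite}) mod 4 = 1"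
  shows "(-1::'a) \<in> nzsq"
proof -
  define k where "k = CARD('a) div 4"
  have q: "CARD('a) = 2 * (2 * k) + 1" using assms unfolding k_def by presburger
  show ?thesis unfolding nzsq_eq_power_half_card(1)[OF q] by simp
qed

text \<open>Every element is a difference of two squares, and \<open>-1 = j ^ 2\<close> turns the
  difference into a sum. Hence at most two steps along scaled squares reach every point of a
  slice.\<close>

lemma sum_of_two_squares:
  fixes a :: "'a::{field,finite}"
  assumes "CARD('a) mod 4 = 1"
  obtains u v where "a = u ^ 2 + v ^ 2"
proof -
  have "odd CARD('a)" using assms by presburger
  then have two: "(2::'a) \<noteq> 0" using one_neq_minus_one[where 'a = 'a]
    by (metis add_eq_0_iff one_add_one)
  obtain j :: 'a where j: "-1 = j ^ 2" using minus_one_in_nzsq[OF assms] by (auto simp: nzsq_def)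
  have "((a + 1) / 2) ^ 2 - ((a - 1) / 2) ^ 2 = (4 * a) / (2 * 2)"
    by (simp add: power_divide power2_eq_square diff_divide_distrib[symmetric] algebra_simps)
  also have "\<dots> = (2 * 2) * a / (2 * 2)" by simp
  also have "\<dots> = a"
    by (rule nonzero_mult_div_cancel_left) (simp only: mult_eq_0_iff two not_False_eq_True simp_thms)
  finally have "a = ((a + 1) / 2) ^ 2 + (j * ((a - 1) / 2)) ^ 2"
    by (simp only: power_mult_distrib j[symmetric]) simp
  then show ?thesis by (rule that)
qed

text \<open>Multiplication by \<open>c\<close> either preserves squares and nonsquares or exchanges
  them, and does so in the same way for \<open>d\<close> and \<open>d'\<close>.\<close>

lemma nzsq_iff_if_scaled_nzsq_iff:
  fixes d d' c :: "'a::{field,finite}"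
  assumes odd: "odd CARD('a)" and nz: "c \<noteq> 0" "d \<noteq> 0" "d' \<noteq> 0"
    and iff: "d \<in> (*) c ` nzsq \<longleftrightarrow> d' \<in> (*) c ` nzsq"
  shows "d \<in> nzsq \<longleftrightarrow> d' \<in> nzsq"
proof -
  have scaled: "x \<in> (*) c ` nzsq \<longleftrightarrow> x / c \<in> nzsq" for x
    using nz(1) by (auto intro!: image_eqI[of _ _ "x / c"])
  have "quad_char (d / c) = quad_char (d' / c)"
    using iff nz by (simp add: scaled quad_char_def)
  then have "quad_char c * quad_char (d / c) = quad_char c * quad_char (d' / c)" by simp
  then have "quad_char d = quad_char d'" using nz by (simp flip: quad_char_mult[OF odd])
  then show ?thesis using nz by (auto simp: quad_char_def split: if_splits)
qed

text \<open>By the walk count, \<open>f\<close> keeps two points that differ by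
  \<open>c * z ^ 2\<close> in a common slice, and at most two such differences join any points of a
  slice. Preserving \<open>c\<close> times the squares then amounts to preserving the
  squares.\<close>

lemma graph_iso_slices:
  fixes \<alpha> \<beta> :: "'a::{field,finite} \<Rightarrow> int"
  assumes l: "prime l" and ch: "\<not> CHAR('a) dvd nat l" and q4: "CARD('a) mod 4 = 1"
    and \<alpha>: "voltage l \<alpha>" and \<beta>: "voltage l \<beta>" and f: "graph_iso l \<alpha> \<beta> f" and i: "i \<in> {0..<l}"
  shows "snd (f (x, i)) = snd (f (0, i))"
    and "bij (\<lambda>x. fst (f (x, i)))"
    and "fst (f (x, i)) - fst (f (y, i)) \<in> nzsq \<longleftrightarrow> x - y \<in> nzsq"
proof -
  define c :: 'a where "c = of_nat (nat l)"
  have c: "c \<noteq> 0" using ch by (simp add: c_def of_nat_eq_0_iff_char_dvd)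
  have odd: "odd CARD('a)" using q4 by presburger
  have key: "snd (f (x, i)) = snd (f (y, i)) \<and> fst (f (y, i)) - fst (f (x, i)) \<in> (*) c ` nzsq \<longleftrightarrow>
      y - x \<in> (*) c ` nzsq" for x y
    using graph_iso_preserves_scaled_slices[OF l ch \<alpha> \<beta> f, of "(x, i)" "(y, i)"] i
    by (simp add: verts_def c_def)
  have move: "snd (f (x + c * z ^ 2, i)) = snd (f (x, i))" for x z
  proof (cases "z = 0")
    case False
    then have "z ^ 2 \<in> nzsq" by (auto simp: nzsq_def)
    then show ?thesis using key[of x "x + c * z ^ 2"] by auto
  qed simp
  show slice: "snd (f (x, i)) = snd (f (0, i))" for x
  proof -
    obtain u v where uv: "x / c = u ^ 2 + v ^ 2" using sum_of_two_squares[OF q4] by blast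
    have "x = 0 + c * u ^ 2 + c * v ^ 2" using uv c by (simp add: field_simps)
    then show ?thesis using move[of "0 + c * u ^ 2" v] move[of 0 u] by simp
  qed
  have inj: "fst (f (x, i)) = fst (f (y, i)) \<Longrightarrow> x = y" for x y
  proof -
    assume "fst (f (x, i)) = fst (f (y, i))"
    then have "f (x, i) = f (y, i)" using slice[of x] slice[of y] by (simp add: prod_eq_iff)
    moreover have "inj_on f (verts l)" using f by (simp add: graph_iso_def bij_betw_def)
    ultimately show "x = y" using i by (auto simp: verts_def dest!: inj_onD)
  qed
  then show "bij (\<lambda>x. fst (f (x, i)))"
    by (simp add: bij_def finite_UNIV_inj_surj inj_def)
  show "fst (f (x, i)) - fst (f (y, i)) \<in> nzsq \<longleftrightarrow> x - y \<in> nzsq"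
  proof (cases "x = y")
    case False
    then have "fst (f (x, i)) \<noteq> fst (f (y, i))" using inj by blast
    then show ?thesis
      using key[of y x] slice[of x] slice[of y] False
      by (intro nzsq_iff_if_scaled_nzsq_iff[OF odd c]) auto
  qed simp
qed

text \<open>Carlitz' theorem describes \<open>f\<close> on each slice. Edges between the slices
  \<open>i\<close> and \<open>i + a\<close> force equal semilinear parts by the estimate for cosets
  consisting of squares, and a nonzero voltage \<open>a\<close> generates the cyclic group of prime
  order \<open>l\<close>.\<close>

lemma graph_iso_semilinear:
  fixes \<alpha> \<beta> :: "'a::{field,finite} \<Rightarrow> int"
  assumes p: "prime p" "CHAR('a) = p" "CARD('a) = p ^ r" and q4: "CARD('a) mod 4 = 1"
    and l: "prime l" "l \<noteq> int p" and \<alpha>: "voltage l \<alpha>" and \<beta>: "voltage l \<beta>" and f: "graph_iso l \<alpha> \<beta> f"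
  obtains t \<sigma> c \<pi> where "t \<in> nzsq" "field_aut \<sigma>"
    "\<And>x i. i \<in> {0..<l} \<Longrightarrow> f (x, i) = (t * \<sigma> x + c i, \<pi> i)"
proof -
  have odd: "odd CARD('a)" using q4 by presburger
  have l0: "l > 0" using l by (simp add: prime_gt_0_int)
  have ch: "\<not> CHAR('a) dvd nat l"
    using primes_dvd_imp_eq[OF p(1), of "nat l"] l p(2) l0 by auto
  note slices = graph_iso_slices[OF l(1) ch q4 \<alpha> \<beta> f]
  have "\<forall>i. \<exists>t \<sigma> c. i \<in> {0..<l} \<longrightarrow> t \<in> nzsq \<and> field_aut \<sigma> \<and> (\<forall>x. fst (f (x, i)) = t * \<sigma> x + c)"
  proof
    fix i
    show "\<exists>t \<sigma> c. i \<in> {0..<l} \<longrightarrow> t \<in> nzsq \<and> field_aut \<sigma> \<and> (\<forall>x. fst (f (x, i)) = t * \<sigma> x + c)"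
    proof (cases "i \<in> {0..<l}")
      case True
      show ?thesis
        by (rule paley_automorphism_semilinear[OF p odd slices(2,3)[OF True]]) blast
    qed blast
  qed
  then obtain t \<sigma> c where tsc: "\<And>i. i \<in> {0..<l} \<Longrightarrow> t i \<in> nzsq" "\<And>i. i \<in> {0..<l} \<Longrightarrow> field_aut (\<sigma> i)"
      "\<And>i x. i \<in> {0..<l} \<Longrightarrow> fst (f (x, i)) = t i * \<sigma> i x + c i"
    by metis
  obtain s where s: "s \<in> nzsq" "\<alpha> s \<noteq> 0" using \<alpha> by (auto simp: voltage_def)
  define a where "a = \<alpha> s"
  have a: "0 < a" "a < l" using \<alpha> s by (force simp: voltage_def a_def)+
  have step: "t ((i + a) mod l) = t i \<and> \<sigma> ((i + a) mod l) = \<sigma> i" if i: "i \<in> {0..<l}" for i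
  proof -
    let ?j = "(i + a) mod l"
    have j: "?j \<in> {0..<l}" using l0 by simp
    \<comment> \<open>Sliding the edge from \<open>(x, i)\<close> to \<open>(x + s, ?j)\<close>
      along \<open>x\<close> produces a whole coset of squares; its first summand does not depend on
      \<open>x\<close>.\<close>
    have "(t ?j * \<sigma> ?j s + c ?j - c i) + (t ?j * \<sigma> ?j x - t i * \<sigma> i x) \<in> nzsq" for x
    proof -
      have "adj l \<alpha> (x, i) (x + s, ?j)" using i j s a by (simp add: adj_def mod_simps a_def)
      then have "adj l \<beta> (f (x, i)) (f (x + s, ?j))"
        using f i j by (simp add: graph_iso_def verts_def)
      then have "fst (f (x + s, ?j)) - fst (f (x, i)) \<in> nzsq" by (simp add: adj_def)
      moreover have "fst (f (x + s, ?j)) - fst (f (x, i)) =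
          (t ?j * \<sigma> ?j s + c ?j - c i) + (t ?j * \<sigma> ?j x - t i * \<sigma> i x)"
        by (simp only: tsc(3)[OF i] tsc(3)[OF j] field_autD(2)[OF tsc(2)[OF j]] distrib_left) simp
      ultimately show ?thesis by simp
    qed
    moreover have "t i \<noteq> 0" "t ?j \<noteq> 0" using tsc(1)[OF i] tsc(1)[OF j] by (auto simp: nzsq_def)
    ultimately show ?thesis
      using semilinear_difference_in_nzsq[OF odd tsc(2)[OF i] tsc(2)[OF j]] by blast
  qed
  have multiples: "t ((int k * a) mod l) = t 0 \<and> \<sigma> ((int k * a) mod l) = \<sigma> 0" for k
  proof (induction k)
    case (Suc k)
    have "((int k * a) mod l + a) mod l = (int (Suc k) * a) mod l" by (simp add: mod_simps algebra_simps)
    then show ?case using step[of "(int k * a) mod l"] Suc l0 by simp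
  qed simp
  have const: "t i = t 0 \<and> \<sigma> i = \<sigma> 0" if i: "i \<in> {0..<l}" for i
  proof -
    have "\<not> l dvd a" using a zdvd_not_zless by blast
    then have "coprime a l" using prime_imp_coprime[OF l(1)] coprime_commute by blast
    then obtain b where b: "[a * b = 1] (mod l)" using cong_solve_coprime_int by blast
    define k where "k = nat ((b * i) mod l)"
    have "int k = (b * i) mod l" using l0 by (simp add: k_def)
    then have "(int k * a) mod l = (a * b * i) mod l" by (simp add: mod_simps algebra_simps)
    also have "\<dots> = (1 * i) mod l" using b by (intro mod_mult_cong) (simp_all add: cong_def)
    finally have "(int k * a) mod l = i" using i by simp
    then show ?thesis using multiples[of k] by simp
  qed
  have f_eq: "f (x, i) = (t 0 * \<sigma> 0 x + c i, snd (f (0, i)))" if "i \<in> {0..<l}" for x i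
    using tsc(3)[OF that, of x] const[OF that] slices(1)[OF that, of x] by (simp add: prod_eq_iff)
  have "0 \<in> {0..<l}" using l0 by simp
  from tsc(1)[OF this] tsc(2)[OF this] f_eq show ?thesis by (rule that)
qed

text \<open>This serves to remove the semilinear part: \<open>\<psi>\<close> inverts
  \<open>x \<mapsto> t * \<sigma> x\<close>, so a step \<open>t * \<sigma> s\<close> in the graph of
  \<open>\<beta>\<close> becomes the step \<open>s\<close> with the same voltage.\<close>

lemma graph_iso_field_twist:
  fixes \<beta> :: "'a::{field,finite} \<Rightarrow> int"
  assumes t: "t \<in> nzsq" and \<sigma>: "field_aut \<sigma>" and \<psi>: "\<And>y. t * \<sigma> (\<psi> y) = y"
  shows "graph_iso l \<beta> (\<lambda>s. \<beta> (t * \<sigma> s)) (\<lambda>(x, i). (\<psi> x, i))"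
proof -
  have inj: "inj \<psi>" by (rule inj_on_inverseI[where g = "\<lambda>y. t * \<sigma> y"]) (rule \<psi>)
  then have "bij \<psi>" by (simp add: bij_def finite_UNIV_inj_surj)
  then have bij: "bij_betw (\<lambda>(x, i). (\<psi> x, i)) (verts l) (verts l)"
    unfolding verts_def bij_betw_def inj_on_def by (auto simp: bij_def inj_def surj_def image_iff)
  have diff: "t * \<sigma> (\<psi> y - \<psi> x) = y - x" for x y
    by (simp only: field_aut_diff[OF \<sigma>] right_diff_distrib \<psi>)
  have "\<psi> y - \<psi> x \<in> nzsq \<longleftrightarrow> y - x \<in> nzsq" for x y
    using nzsq_mult_field_aut_iff[OF \<sigma> t, of "\<psi> y - \<psi> x"] by (simp add: diff)
  then show ?thesis using bij by (auto simp: graph_iso_def adj_def diff)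
qed

text \<open>Proportional voltages suffice for an isomorphism of the required shape. This is applied
  with the final multiplier \<open>n\<close> and, for the covering isomorphism, with multiplier
  \<open>1\<close> to voltages that are already scaled.\<close>

lemma graph_iso_semilinear_scaling:
  fixes \<alpha> \<beta> :: "'a::{field,finite} \<Rightarrow> int"
  assumes l: "l > 0" and n: "coprime n l" and \<alpha>: "\<forall>s\<in>nzsq. \<alpha> s \<in> {0..<l}"
    and t: "t \<in> nzsq" and \<sigma>: "field_aut \<sigma>" and eq: "\<And>s. s \<in> nzsq \<Longrightarrow> (n * \<alpha> s) mod l = \<beta> (t * \<sigma> s)"
  shows "graph_iso l \<alpha> \<beta> (\<lambda>(x, i). (t * \<sigma> x, (n * i) mod l))"
  unfolding graph_iso_def
proof (intro conjI ballI)
  let ?g = "\<lambda>(x, i). (t * \<sigma> x, (n * i) mod l)"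
  have t0: "t \<noteq> 0" using t by (simp add: nzsq_def)
  have cancel: "(n * i) mod l = (n * j) mod l \<longleftrightarrow> i mod l = j mod l" for i j
    using cong_mult_lcancel[OF n, of i j] by (simp add: cong_def)
  have fin: "finite (verts l :: ('a \<times> int) set)" by (simp add: verts_def)
  have "inj_on ?g (verts l)"
    by (rule inj_onI) (auto simp: verts_def cancel t0 field_aut_eq_iff[OF \<sigma>])
  moreover have "?g ` verts l \<subseteq> verts l" using l by (auto simp: verts_def)
  ultimately show "bij_betw ?g (verts l) (verts l)"
    using endo_inj_surj[OF fin] by (simp add: bij_betw_def)
  fix v w :: "'a \<times> int" assume vw: "v \<in> verts l" "w \<in> verts l"
  obtain x i y j where xy: "v = (x, i)" "w = (y, j)" by fastforce
  have diff: "t * \<sigma> y - t * \<sigma> x = t * \<sigma> (y - x)"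
    by (simp only: field_aut_diff[OF \<sigma>] right_diff_distrib)
  have "((n * j) mod l - (n * i) mod l) mod l = \<beta> (t * \<sigma> (y - x)) \<longleftrightarrow> (j - i) mod l = \<alpha> (y - x)"
    if "y - x \<in> nzsq"
  proof -
    have "((n * j) mod l - (n * i) mod l) mod l = (n * (j - i)) mod l"
      by (simp add: mod_simps right_diff_distrib)
    moreover have "\<alpha> (y - x) mod l = \<alpha> (y - x)" using \<alpha> that by auto
    ultimately show ?thesis using cancel[of "j - i" "\<alpha> (y - x)"] eq[OF that] by simp
  qed
  then show "adj l \<alpha> v w \<longleftrightarrow> adj l \<beta> (?g v) (?g w)"
    using vw l by (auto simp: xy adj_def verts_def diff nzsq_mult_field_aut_iff[OF \<sigma> t])
qed

theorem theorem1p2: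
  fixes p r :: nat and l :: int
    and \<alpha> \<beta> :: "'a::{field,finite} \<Rightarrow> int"
  assumes "prime p" and "r \<ge> 1" and "CARD('a) = p ^ r" and "CHAR('a) = p"
    and "CARD('a) mod 4 = 1"
    and "prime l" and "l \<noteq> int p"
    and "r \<le> 4 \<or> 2 * l > int CARD('a) - 1"
    and "voltage l \<alpha>" and "voltage l \<beta>"
    and "graphs_isomorphic l \<alpha> \<beta>"
  shows "\<exists>t \<sigma> n. t \<in> nzsq \<and> field_aut \<sigma> \<and> n \<in> {1..<l} \<and>
           graph_iso l \<alpha> \<beta> (\<lambda>(x, i). (t * \<sigma> x, (n * i) mod l)) \<and>
           (\<forall>s\<in>nzsq. (n * \<alpha> s) mod l = \<beta> (t * \<sigma> s)) \<and>
           (\<exists>g. cover_iso l (scale_volt l n \<alpha>) \<beta> g)"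
proof -
  have l0: "l > 0" using assms(6) by (simp add: prime_gt_0_int)
  have ql: "\<not> nat l dvd CARD('a)"
  proof
    assume "nat l dvd CARD('a)"
    moreover have pl: "prime (nat l)" using assms(6) by simp
    ultimately have "nat l dvd p" using assms(3) prime_dvd_power by metis
    then show False using primes_dvd_imp_eq[OF pl assms(1)] assms(7) l0 by simp
  qed
  have \<alpha>: "\<forall>s\<in>nzsq. \<alpha> s \<in> {0..<l}" using assms(9) by (simp add: voltage_def)
  obtain f where f: "graph_iso l \<alpha> \<beta> f" using assms(11) by (auto simp: graphs_isomorphic_def)
  obtain t \<sigma> c \<pi> where t: "t \<in> nzsq" and \<sigma>: "field_aut \<sigma>"
    and f_eq: "\<And>x i. i \<in> {0..<l} \<Longrightarrow> f (x, i) = (t * \<sigma> x + c i, \<pi> i)"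
    using graph_iso_semilinear[OF assms(1,4,3,5,6,7,9,10) f] by blast
  have t0: "t \<noteq> 0" using t by (simp add: nzsq_def)
  define \<psi> where "\<psi> y = inv_into UNIV \<sigma> (y / t)" for y
  have \<psi>: "t * \<sigma> (\<psi> y) = y" for y
    using t0 field_autD(1)[OF \<sigma>] by (simp add: \<psi>_def bij_def surj_f_inv_f)
  have \<psi>_add: "\<psi> (t * \<sigma> x + y) = \<psi> y + x" for x y
  proof -
    have "t * \<sigma> (\<psi> (t * \<sigma> x + y)) = t * \<sigma> (\<psi> y + x)"
      by (simp only: \<psi> field_autD(2)[OF \<sigma>] distrib_left) (simp add: add.commute)
    then show ?thesis using t0 by (simp add: field_aut_eq_iff[OF \<sigma>])
  qed
  \<comment> \<open>Composing \<open>f\<close> with \<open>\<psi>\<close> makes it commute with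
    translations, and the rotation by \<open>- \<pi> 0\<close> fixes the slice over
    \<open>0\<close>; the values off the vertices are chosen so that \<open>h\<close> is a
    shear.\<close>
  define h where "h v = (if v \<in> verts l then
      (fibre_rot l (- \<pi> 0) \<circ> ((\<lambda>(x, i). (\<psi> x, i)) \<circ> f)) v else v)" for v
  have "graph_iso l \<alpha> (\<lambda>s. \<beta> (t * \<sigma> s)) (fibre_rot l (- \<pi> 0) \<circ> ((\<lambda>(x, i). (\<psi> x, i)) \<circ> f))"
    by (intro graph_iso_comp[OF graph_iso_comp[OF f graph_iso_field_twist[OF t \<sigma> \<psi>]]] fibre_rot_graph_iso[OF l0])
  then have h_iso: "graph_iso l \<alpha> (\<lambda>s. \<beta> (t * \<sigma> s)) h"
    by (rule graph_iso_cong[rotated]) (simp add: h_def)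
  have \<pi>: "\<pi> i \<in> {0..<l}" if "i \<in> {0..<l}" for i
  proof -
    have "bij_betw f (verts l) (verts l)" using f by (simp only: graph_iso_def)
    moreover have "(0, i) \<in> verts l" using that by (simp add: verts_def)
    ultimately have "f (0, i) \<in> verts l" by (rule bij_betw_apply)
    then show ?thesis by (simp add: f_eq[OF that] verts_def)
  qed
  have h_eq: "h (x, i) = (\<psi> (c i) + x, (\<pi> i - \<pi> 0) mod l)" if "i \<in> {0..<l}" for x i
    using that \<pi>[OF that] by (simp add: h_def verts_def f_eq[OF that] fibre_rot_def \<psi>_add)
  have "h permutes verts l"
  proof (rule bij_imp_permutes)
    show "bij_betw h (verts l) (verts l)" using h_iso by (simp only: graph_iso_def)
  qed (simp only: h_def if_False)
  then have h: "h \<in> shears l"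
    using l0 by (simp add: shears_def h_eq add.assoc)
  obtain n where n: "n \<in> {1..<l}" "\<And>s. s \<in> nzsq \<Longrightarrow> (n * \<alpha> s) mod l = \<beta> (t * \<sigma> s)"
    by (rule shear_iso_imp_voltages_proportional[OF assms(6) ql \<alpha> h h_iso]) blast
  have "\<not> l dvd n" using n(1) zdvd_not_zless[of n l] by auto
  then have "coprime n l" using prime_imp_coprime[OF assms(6)] coprime_commute by blast
  then have "graph_iso l \<alpha> \<beta> (\<lambda>(x, i). (t * \<sigma> x, (n * i) mod l))"
    by (rule graph_iso_semilinear_scaling[OF l0 _ \<alpha> t \<sigma> n(2)])
  \<comment> \<open>The factor in \<open>1 * i\<close> lets
    \<open>graph_iso_semilinear_scaling\<close> apply with \<open>n = 1\<close>. The fibre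
    coordinate of a vertex is left unchanged, so the map commutes with the deck group.\<close>
  moreover have "cover_iso l (scale_volt l n \<alpha>) \<beta> (\<lambda>(x, i). (t * \<sigma> x, (1 * i) mod l))"
    unfolding cover_iso_def
  proof (intro conjI)
    show "graph_iso l (scale_volt l n \<alpha>) \<beta> (\<lambda>(x, i). (t * \<sigma> x, (1 * i) mod l))"
      by (rule graph_iso_semilinear_scaling[OF l0 _ _ t \<sigma>]) (simp_all add: scale_volt_def l0 flip: n(2))
  qed (simp add: mod_add_left_eq)
  ultimately show ?thesis
    using t \<sigma> n by (intro exI[of _ t] exI[of _ \<sigma>] exI[of _ n] conjI ballI exI) simp_all
qed

end
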